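(* For each $n$ let $\boldsymbol d=\boldsymbol d^{(n)}=(d_1,\dots,d_n)$ be a sequence of positive integers with even sum, and let $D_n$ be the degree of a uniformly chosen vertex. Suppose that there is a random variable $D$ such that $D_n$ converges in distribution to $D$ as $n\to\infty$, that $\mathbb E[D_n]\to\mathbb E[D]<\infty$, and that $\lim_{n\to\infty}\mathbb E[D_n^2]=\mathbb E[D^2]<\infty$. Let $\nu=\mathbb E[D(D-1)]/\mathbb E[D]$. Then, for the configuration model $\mathrm{CM}_n(\boldsymbol d)$, $$d_{\mathrm{TV}}\big(\mathcal L(S_n,M_n),\ \mathrm{Poi}(\nu/2)\otimes\mathrm{Poi}(\nu^2/4)\big)\to 0\qquad (n\to\infty).$$
   Context: Configuration model: given positive integers $\boldsymbol d=(d_1,\dots,d_n)$ with even sum $\ell_n=\sum_{i\in[n]}d_i$, where $[n]=\{1,\dots,n\}$, attach $d_i$ half-edges to vertex $i$ for each $i\in[n]$, and match the $\ell_n$ half-edges in pairs uniformly at random; each pair forms an edge. The resulting random multigraph on $[n]$ is $\mathrm{CM}_n(\boldsymbol d)$. For $i,j\in[n]$, $X_{ij}$ is the number of edges between $i$ and $j$ ($X_{ii}$ is the number of self-loops at $i$). Define $$S_n=\sum_{i\in[n]}X_{ii},\qquad M_n=\sum_{1\le i<j\le n}\binom{X_{ij}}{2}.$$ The random variable $D_n=d_V$ with $V$ uniform on $[n]$ has distribution function $F_n(x)=\frac1n\sum_{j\in[n]}\mathbf 1\{d_j\le x\}$. $\mathcal L(\cdot)$ denotes the law of a random variable or vector,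 $\mathrm{Poi}(\lambda)$ is the Poisson distribution with mean $\lambda$, $\otimes$ denotes product measure, and $d_{\mathrm{TV}}$ is total variation distance. *)

theory Defs
  imports "HOL-Probability.Probability" "HOL-Library.Multiset" "HOL-Library.Disjoint_Sets"
begin

section \<open>The configuration model\<close>

text \<open>The \<open>k\<close>-th half-edge at vertex \<open>i\<close> is the pair \<open>(i, k)\<close> with \<open>k < d i\<close>;
  the vertex set is \<open>{1..n}\<close>.\<close>

definition half_edges :: "nat \<Rightarrow> (nat \<Rightarrow> nat) \<Rightarrow> (nat \<times> nat) set" where
  "half_edges n d = (SIGMA i:{1..n}. {..<d i})"

definition perfect_matchings :: "'a set \<Rightarrow> 'a set set set" where
  "perfect_matchings H = {P. partition_on H P \<and> (\<forall>e\<in>P. card e = 2)}"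

text \<open>A multigraph is represented by the multiset of its edges, where an edge is the set of its
  end points, so a self-loop at \<open>i\<close> is \<open>{i}\<close>.\<close>

type_synonym multigraph = "nat set multiset"

definition multigraph_of_matching :: "(nat \<times> nat) set set \<Rightarrow> multigraph" where
  "multigraph_of_matching P = image_mset (\<lambda>e. fst ` e) (mset_set P)"

text \<open>For \<^prop>\<open>even (\<Sum>i\<in>{1..n}. d i)\<close> the set of perfect matchings is finite and nonempty, so
  that \<^const>\<open>pmf_of_set\<close> is the uniform distribution on it.\<close>

definition configuration_model :: "nat \<Rightarrow> (nat \<Rightarrow> nat) \<Rightarrow> multigraph pmf" where
  "configuration_model n d =
     map_pmf multigraph_of_matching (pmf_of_set (perfect_matchings (half_edges n d)))"

definition edge_count :: "multigraph \<Rightarrow> nat \<Rightarrow> nat \<Rightarrow> nat" where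
  "edge_count G i j = count G {i, j}"

definition self_loops :: "nat \<Rightarrow> multigraph \<Rightarrow> nat" where
  "self_loops n G = (\<Sum>i\<in>{1..n}. edge_count G i i)"

definition multi_edges :: "nat \<Rightarrow> multigraph \<Rightarrow> nat" where
  "multi_edges n G = (\<Sum>i\<in>{1..n}. \<Sum>j\<in>{i<..n}. edge_count G i j choose 2)"

definition degree_pmf :: "nat \<Rightarrow> (nat \<Rightarrow> nat) \<Rightarrow> real pmf" where
  "degree_pmf n d = map_pmf (\<lambda>i. real (d i)) (pmf_of_set {1..n})"


section \<open>Poisson distribution and total variation distance\<close>

text \<open>\<^const>\<open>poisson_pmf\<close> is only specified for a positive rate.\<close>

definition Poi :: "real \<Rightarrow> nat pmf" where
  "Poi r = (if r = 0 then return_pmf 0 else poisson_pmf r)"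

lemma pmf_Poi: "r \<ge> 0 \<Longrightarrow> pmf (Poi r) k = r ^ k / fact k * exp (- r)"
  by (cases k) (auto simp: Poi_def)

definition tv_dist :: "'a pmf \<Rightarrow> 'a pmf \<Rightarrow> real" where
  "tv_dist p q = (SUP A. \<bar>measure_pmf.prob p A - measure_pmf.prob q A\<bar>)"

end

theory Submission
  imports Defs
begin

text \<open>Forcing a pair of half-edges \<open>x\<close>, \<open>y\<close> to be matched by the switch \<open>xu, yw \<mapsto> xy, uw\<close> turns the
  uniform matching into the uniform matching conditioned on containing \<open>xy\<close>.  If \<open>x\<close> and \<open>y\<close> sit at
  the same vertex, then typically the only effect on \<open>(S, M)\<close> is \<open>S \<mapsto> S + 1\<close>; two switches that
  create a double edge typically have the only effect \<open>M \<mapsto> M + 1\<close>.  The exceptional probabilities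
  are bounded by the maximal degree, which is \<open>o(\<surd>n)\<close> since \<open>D\<^sub>n\<^sup>2\<close> is uniformly integrable.
  Summing over all \<open>x\<close>, \<open>y\<close> shows that \<open>p\<^sub>n(a, b) = P(S = a, M = b)\<close> satisfies the Poisson recursions
  \<open>(a + 1) p\<^sub>n(a + 1, b) = \<nu>/2 p\<^sub>n(a, b) + o(1)\<close> and
  \<open>(b + 1) p\<^sub>n(a, b + 1) = \<nu>\<^sup>2/4 p\<^sub>n(a, b) + o(1)\<close>.  Together with the bounded first moments this
  forces pointwise convergence to the product of the Poisson laws, hence convergence in total
  variation.\<close>

section \<open>Switching in perfect matchings\<close>

text \<open>Switching itself is exact: \<open>P\<close> can be recovered from the switched matching
  and the old partner of \<open>x\<close>, so only the effect of a switch on loops and multiple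
  edges has to be estimated. The obstacle is that no moment beyond the second is controlled. A
  prescribed pair is matched with probability at most \<open>r = 2 / card H\<close>, a switch
  misbehaves with probability of order \<open>r * \<Delta>\<^sup>2\<close>, and the ordered pairs of
  half-edges at a common vertex number the sum of squared degrees, whose product with
  \<open>r\<close> stays bounded. The total error is thus of order
  \<open>\<Delta>\<^sup>2 / n\<close>. Ordered half-edges count a loop twice and a pair of parallel
  edges four times; this gives the denominators in \<nu>/2 and \<nu>^2/4. The square arises because
  the tuples for double edges are nearly all pairs of tuples for loops. A double edge needs a second
  switch that keeps the edge made by the first, so the statements carry a set \<open>B\<close> of
  forced edges. The identities are proved for test functions with values in [0,1]: an indicator
  yields the recursions, the constant 1 the first moments.\<close>

lemma perfect_matchings_edge:
  assumes "P \<in> perfect_matchings H" "{x, y} \<in> P"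
  shows "x \<in> H" "y \<in> H" "x \<noteq> y"
  using assms by (auto simp: perfect_matchings_def partition_on_def)

lemma perfect_matchings_unique:
  assumes "P \<in> perfect_matchings H" "e \<in> P" "e' \<in> P" "x \<in> e" "x \<in> e'"
  shows "e = e'"
  using assms by (auto simp: perfect_matchings_def partition_on_def disjoint_def)

lemma perfect_matchings_edgeE:
  assumes "P \<in> perfect_matchings H" "e \<in> P" "x \<in> e"
  obtains y where "e = {x, y}" "y \<noteq> x"
  using assms by (fastforce simp: perfect_matchings_def card_2_iff)

lemma perfect_matchings_covers:
  assumes "P \<in> perfect_matchings H" "x \<in> H"
  obtains y where "{x, y} \<in> P"
proof -
  from assms obtain e where "e \<in> P" "x \<in> e"
    by (auto simp: perfect_matchings_def partition_on_def)
  with that show thesis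
    using perfect_matchings_edgeE[OF assms(1)] by metis
qed

section \<open>Partners, existence and relabelling of perfect matchings\<close>

definition partner :: "'a set set \<Rightarrow> 'a \<Rightarrow> 'a" where
  "partner P x = (THE y. {x, y} \<in> P)"

lemma partner_eq:
  assumes "P \<in> perfect_matchings H" "{x, y} \<in> P"
  shows "partner P x = y"
  unfolding partner_def
proof (rule the_equality)
  show "{x, y} \<in> P" by fact
  show "z = y" if "{x, z} \<in> P" for z
    using perfect_matchings_unique[OF assms(1) that assms(2), of x] by (auto simp: doubleton_eq_iff)
qed

lemma partner_edge:
  assumes "P \<in> perfect_matchings H" "x \<in> H"
  shows "{x, partner P x} \<in> P"
  using perfect_matchings_covers[OF assms] partner_eq[OF assms(1)] by metis

lemma finite_perfect_matchings:
  assumes "finite H"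
  shows "finite (perfect_matchings H)"
  by (rule finite_subset[of _ "Pow (Pow H)"])
    (use assms in \<open>auto simp: perfect_matchings_def partition_on_def\<close>)

lemma finite_perfect_matching:
  assumes "finite H" "P \<in> perfect_matchings H"
  shows "finite P"
  using assms by (auto simp: perfect_matchings_def partition_on_def intro: finite_UnionD)

lemma perfect_matchings_nonempty:
  assumes "finite H" "even (card H)"
  shows "perfect_matchings H \<noteq> {}"
  using assms
proof (induction "card H" arbitrary: H rule: less_induct)
  case less
  show ?case
  proof (cases "H = {}")
    case True
    then have "{} \<in> perfect_matchings H"
      by (simp add: perfect_matchings_def partition_on_def disjoint_def)
    then show ?thesis by auto
  next
    case False
    with less.prems have "2 \<le> card H"
      by (metis One_nat_def Suc_1 card_gt_0_iff dvd_imp_le)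
    then obtain e where e: "e \<subseteq> H" "card e = 2"
      by (metis obtain_subset_with_card_n)
    then have fin: "finite e" using finite_subset less.prems(1) by auto
    have c: "card (H - e) = card H - 2" using e fin by (simp add: card_Diff_subset)
    have "perfect_matchings (H - e) \<noteq> {}"
      by (rule less.hyps) (use less.prems \<open>2 \<le> card H\<close> c in auto)
    then obtain P where P: "P \<in> perfect_matchings (H - e)" by auto
    have "insert e P \<in> perfect_matchings H"
      using P e by (auto simp: perfect_matchings_def partition_on_def disjoint_def)
    then show ?thesis by auto
  qed
qed

lemma perfect_matchings_image:
  assumes P: "P \<in> perfect_matchings H" and s: "inj s" "s ` H = H"
  shows "(`) s ` P \<in> perfect_matchings H"
proof -
  have "\<Union> ((`) s ` P) = s ` \<Union>P" by auto
  then have "\<Union> ((`) s ` P) = H"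
    using P s(2) by (simp add: perfect_matchings_def partition_on_def)
  moreover have "disjoint ((`) s ` P)"
  proof (rule disjointI)
    fix a b assume "a \<in> (`) s ` P" "b \<in> (`) s ` P" "a \<noteq> b"
    then obtain e e' where e: "e \<in> P" "e' \<in> P" "e \<noteq> e'" "a = s ` e" "b = s ` e'" by auto
    then have "e \<inter> e' = {}"
      using P by (auto simp: perfect_matchings_def partition_on_def disjoint_def)
    then show "a \<inter> b = {}" using e s(1) by (simp add: image_Int[symmetric])
  qed
  moreover have "card (s ` e) = card e" for e
    using s(1) by (meson card_image inj_on_subset subset_UNIV)
  ultimately show ?thesis
    using P by (auto simp: perfect_matchings_def partition_on_def)
qed

text \<open>Relabelling \<open>y\<close> and the partner of \<open>x\<close> replaces the edges \<open>xu\<close>, \<open>yw\<close> by \<open>xy\<close>, \<open>uw\<close>, and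
  changes nothing if \<open>xy\<close> is already an edge.\<close>

definition switch :: "'a \<Rightarrow> 'a \<Rightarrow> 'a set set \<Rightarrow> 'a set set" where
  "switch x y P = (`) (Transposition.transpose y (partner P x)) ` P"

section \<open>Counting matchings with forced edges by switching\<close>

lemma perfect_matchings_card:
  assumes "finite H" "P \<in> perfect_matchings H" "B \<subseteq> P"
  shows "card (\<Union>B) = 2 * card B" "\<Union>B \<subseteq> H"
proof -
  have "finite B" using finite_perfect_matching[OF assms(1,2)] assms(3) finite_subset by auto
  have "card (\<Union>B) = (\<Sum>e\<in>B. card e)"
  proof (rule card_Union_disjoint)
    show "pairwise disjnt B"
      using assms by (auto simp: perfect_matchings_def partition_on_def pairwise_def disjoint_def
        disjnt_def)
    show "finite e" if "e \<in> B" for e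
      using assms that by (intro card_ge_0_finite) (auto simp: perfect_matchings_def)
  qed
  also have "\<dots> = (\<Sum>e\<in>B. 2)"
    using assms by (intro sum.cong) (auto simp: perfect_matchings_def)
  finally show "card (\<Union>B) = 2 * card B" by simp
  show "\<Union>B \<subseteq> H" using assms by (auto simp: perfect_matchings_def partition_on_def)
qed

lemma transpose_image_disjoint: "a \<notin> e \<Longrightarrow> b \<notin> e \<Longrightarrow> Transposition.transpose a b ` e = e"
  by (auto simp: transpose_def image_iff)

text \<open>\<open>B\<close> holds the edges that are already forced: none for a first switch, one
  for a second. Larger sets occur only in the union bounds.\<close>

definition matchings_with :: "'a set \<Rightarrow> 'a set set \<Rightarrow> 'a set set set" where
  "matchings_with H B = {P \<in> perfect_matchings H. B \<subseteq> P}"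

text \<open>A forced edge through the partner of \<open>x\<close> would have to be the edge of
  \<open>x\<close> itself, so both relabelled half-edges avoid \<open>B\<close> and the forced edges
  stay fixed. After the switch \<open>y\<close> is the partner of \<open>x\<close>; switching to the
  old partner therefore applies the same transposition once more and undoes the change.\<close>

lemma switch_matchings_with:
  assumes P: "P \<in> matchings_with H B"
    and x: "x \<in> H - \<Union>B" and y: "y \<in> H - \<Union>B" and "x \<noteq> y"
  shows "switch x y P \<in> matchings_with H B" "{x, y} \<in> switch x y P"
    "partner P x \<in> H - \<Union>B - {x}" "switch x (partner P x) (switch x y P) = P"
proof -
  let ?u = "partner P x" and ?t = "Transposition.transpose y (partner P x)"
  have PM: "P \<in> perfect_matchings H" and B: "B \<subseteq> P" using P by (auto simp: matchings_with_def)
  have xu: "{x, ?u} \<in> P" using partner_edge[OF PM] x by auto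
  show u: "?u \<in> H - \<Union>B - {x}"
  proof -
    have "?u \<notin> \<Union>B"
    proof
      assume "?u \<in> \<Union>B"
      then obtain e where "e \<in> B" "?u \<in> e" by auto
      then have "e = {x, ?u}" using perfect_matchings_unique[OF PM _ xu, of e ?u] B by auto
      with \<open>e \<in> B\<close> x show False by auto
    qed
    then show ?thesis using perfect_matchings_edge[OF PM xu] by auto
  qed
  have "?t ` H = H" using y u by simp
  then have sw: "switch x y P \<in> perfect_matchings H"
    unfolding switch_def by (intro perfect_matchings_image PM) auto
  have "e \<in> switch x y P" if "e \<in> B" for e
  proof -
    have "?t ` e = e" using that y u by (intro transpose_image_disjoint) auto
    then show ?thesis using that B unfolding switch_def by (metis image_eqI subsetD)
  qed
  then show "switch x y P \<in> matchings_with H B" using sw by (auto simp: matchings_with_def)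
  have "?t ` {x, ?u} = {x, y}" using \<open>x \<noteq> y\<close> u by (auto simp: transpose_def)
  then show xy: "{x, y} \<in> switch x y P" unfolding switch_def using xu by (metis image_eqI)
  have "partner (switch x y P) x = y" using partner_eq[OF sw xy] .
  then show "switch x ?u (switch x y P) = P"
    unfolding switch_def[of x ?u]
    by (simp add: switch_def image_comp transpose_commute[of ?u y] image_image)
qed

text \<open>Remembering the old partner \<open>w\<close> of \<open>x\<close> makes the switch a
  bijection, and \<open>w\<close> may be any half-edge outside \<open>B\<close> other than
  \<open>x\<close>; \<open>w = y\<close> is the case in which nothing changes. So each matching
  through \<open>xy\<close> is hit equally often, which is the exact form of conditioning on
  \<open>xy\<close>.\<close>

lemma sum_switch:
  fixes F :: "'a set set \<Rightarrow> real"
  assumes H: "finite H" and x: "x \<in> H - \<Union>B" and y: "y \<in> H - \<Union>B" and "x \<noteq> y"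
  shows "(\<Sum>P\<in>matchings_with H B. F (switch x y P)) =
    (real (card H) - 2 * real (card B) - 1) * (\<Sum>P\<in>matchings_with H (insert {x, y} B). F P)"
proof -
  let ?A = "matchings_with H B" and ?Q = "matchings_with H (insert {x, y} B)"
  let ?W = "H - \<Union>B - {x}"
  have Q: "?Q = {Q \<in> ?A. {x, y} \<in> Q}" by (auto simp: matchings_with_def)
  have fin: "finite ?A" "finite ?Q"
    using finite_perfect_matchings[OF H] by (auto simp: matchings_with_def)
  have "(\<Sum>P\<in>?A. F (switch x y P)) = (\<Sum>(Q, w)\<in>?Q \<times> ?W. F Q)"
  proof (rule sum.reindex_bij_witness[where
        i = "\<lambda>(Q, w). switch x w Q" and j = "\<lambda>P. (switch x y P, partner P x)"])
    fix P assume P: "P \<in> ?A"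
    note sw = switch_matchings_with[OF P x y \<open>x \<noteq> y\<close>]
    show "(case (switch x y P, partner P x) of (Q, w) \<Rightarrow> switch x w Q) = P" using sw(4) by simp
    show "(switch x y P, partner P x) \<in> ?Q \<times> ?W" using sw Q by auto
    show "(case (switch x y P, partner P x) of (Q, w) \<Rightarrow> F Q) = F (switch x y P)" by simp
  next
    fix p assume p: "p \<in> ?Q \<times> ?W"
    obtain Q w where pq: "p = (Q, w)" by (cases p)
    have Qw: "Q \<in> ?A" "{x, y} \<in> Q" "w \<in> H - \<Union>B" "w \<noteq> x" using p pq Q by auto
    note sw = switch_matchings_with[OF Qw(1) x Qw(3) Qw(4)[symmetric]]
    have "partner Q x = y" using partner_eq Qw by (auto simp: matchings_with_def)
    moreover have "partner (switch x w Q) x = w"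
      using partner_eq sw by (auto simp: matchings_with_def)
    ultimately show "(switch x y (case p of (Q, w) \<Rightarrow> switch x w Q),
        partner (case p of (Q, w) \<Rightarrow> switch x w Q) x) = p"
      using sw(4) pq by simp
    show "(case p of (Q, w) \<Rightarrow> switch x w Q) \<in> ?A" using sw pq by simp
  qed
  also have "\<dots> = real (card ?W) * (\<Sum>Q\<in>?Q. F Q)"
    by (simp add: sum.cartesian_product[symmetric] sum_distrib_left)
  also have "\<dots> = (real (card H) - 2 * real (card B) - 1) * (\<Sum>P\<in>?Q. F P)"
  \<comment> \<open>The size of \<open>?W\<close> is known only if \<open>B\<close> extends to a
    matching, so that its edges are disjoint pairs. If \<open>?Q\<close> is empty, both sides are
    0.\<close>
  proof (cases "?Q = {}")
    case False
    then obtain P where P: "P \<in> perfect_matchings H" "B \<subseteq> P" by (auto simp: matchings_with_def)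
    note c = perfect_matchings_card[OF H P]
    have "finite (\<Union>B)" using c(2) H finite_subset by auto
    then have "card (H - \<Union>B) = card H - 2 * card B" "2 * card B \<le> card H"
      using c H card_mono[OF H c(2)] by (auto simp: card_Diff_subset)
    moreover have "card (H - \<Union>B) \<ge> 1" using x H by (metis One_nat_def Suc_leI card_gt_0_iff empty_iff finite_Diff)
    moreover have "card ?W = card (H - \<Union>B) - 1" using x by (intro card_Diff_singleton) auto
    ultimately have "real (card ?W) = real (card H) - 2 * real (card B) - 1"
      by (simp add: of_nat_diff)
    then show ?thesis by simp
  qed auto
  finally show ?thesis .
qed

text \<open>With at most three forced edges the factor in \<open>sum_switch\<close> is at least
  \<open>card H - 7\<close>, which is at least half of \<open>card H\<close> from 14 on. Nothing is
  asked of \<open>u\<close>: either no matching qualifies, or \<open>u\<close> is automatically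
  free.\<close>

lemma card_matchings_with_insert:
  assumes H: "finite H" and x: "x \<notin> \<Union>B" and B: "card B \<le> 3" and "card H \<ge> 14"
  shows "real (card (matchings_with H (insert {x, u} B))) \<le>
    2 / real (card H) * real (card (matchings_with H B))"
proof (cases "matchings_with H (insert {x, u} B) = {}")
  case False
  then obtain P where P: "P \<in> perfect_matchings H" "B \<subseteq> P" "{x, u} \<in> P"
    by (auto simp: matchings_with_def)
  have "u \<notin> \<Union>B"
    using P x perfect_matchings_unique[OF P(1) _ P(3), of _ u] by blast
  then have xu: "x \<in> H - \<Union>B" "u \<in> H - \<Union>B" "x \<noteq> u"
    using x perfect_matchings_edge[OF P(1,3)] by auto
  let ?c = "real (card (matchings_with H (insert {x, u} B)))"
  have "real (card (matchings_with H B)) = (real (card H) - 2 * real (card B) - 1) * ?c"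
    using sum_switch[OF H xu, of "\<lambda>_. 1"] by simp
  also have "\<dots> \<ge> real (card H) / 2 * ?c"
    using assms by (intro mult_right_mono) auto
  finally show ?thesis using \<open>card H \<ge> 14\<close> by (simp add: field_simps)
qed simp

section \<open>Effect of a switch on loops and multiple edges\<close>

definition edge_mult :: "('h \<Rightarrow> 'v) \<Rightarrow> 'h set set \<Rightarrow> 'v set \<Rightarrow> nat" where
  "edge_mult v P f = card {e \<in> P. v ` e = f}"

lemma edge_mult_insert:
  assumes "finite P" "e \<notin> P"
  shows "edge_mult v (insert e P) f = edge_mult v P f + of_bool (v ` e = f)"
proof -
  have "{e' \<in> insert e P. v ` e' = f} =
      (if v ` e = f then insert e {e \<in> P. v ` e = f} else {e \<in> P. v ` e = f})"
    by auto
  then show ?thesis using assms by (simp add: edge_mult_def)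
qed

text \<open>The matchings before and after a switch share \<open>R\<close> and differ in two edges.
  The four non-membership facts are what \<open>edge_mult_insert\<close> requires to add these edges
  one at a time.\<close>

lemma switch_decomposition:
  assumes P: "P \<in> perfect_matchings H" and "x \<in> H" "y \<in> H" "x \<noteq> y"
    and ne: "partner P x \<noteq> y"
  obtains R where "P = insert {x, partner P x} (insert {y, partner P y} R)"
    "switch x y P = insert {x, y} (insert {partner P x, partner P y} R)"
    "{x, partner P x} \<notin> insert {y, partner P y} R" "{y, partner P y} \<notin> R"
    "{x, y} \<notin> insert {partner P x, partner P y} R" "{partner P x, partner P y} \<notin> R"
proof
  define u w where "u = partner P x" and "w = partner P y"
  define R where "R = P - {{x, u}, {y, w}}"
  have xu: "{x, u} \<in> P" "{y, w} \<in> P"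
    using partner_edge[OF P] assms by (auto simp: u_def w_def)
  have ne: "u \<noteq> y" "x \<noteq> u" "y \<noteq> w" "x \<noteq> w"
    using ne perfect_matchings_edge[OF P xu(1)] perfect_matchings_edge[OF P xu(2)]
      partner_eq[OF P, of x y] xu(2) by (auto simp: u_def insert_commute)
  have "u \<noteq> w" using perfect_matchings_unique[OF P xu, of u] ne \<open>x \<noteq> y\<close> by auto
  have disj: "x \<notin> e" "u \<notin> e" "y \<notin> e" "w \<notin> e" if "e \<in> R" for e
    using that perfect_matchings_unique[OF P _ xu(1), of e x]
      perfect_matchings_unique[OF P _ xu(1), of e u]
      perfect_matchings_unique[OF P _ xu(2), of e y]
      perfect_matchings_unique[OF P _ xu(2), of e w] by (auto simp: R_def)
  show P_eq: "P = insert {x, partner P x} (insert {y, partner P y} R)"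
    using xu by (auto simp: R_def u_def w_def)
  show "{x, partner P x} \<notin> insert {y, partner P y} R"
    using ne \<open>x \<noteq> y\<close> by (auto simp: R_def u_def w_def doubleton_eq_iff)
  show "{y, partner P y} \<notin> R" by (auto simp: R_def w_def)
  show "{x, y} \<notin> insert {partner P x, partner P y} R"
    using ne disj(1)[of "{x, y}"] \<open>x \<noteq> y\<close> by (auto simp: u_def w_def doubleton_eq_iff)
  show "{partner P x, partner P y} \<notin> R"
    using disj(2)[of "{u, w}"] by (auto simp: u_def w_def)
  let ?t = "Transposition.transpose y u"
  have "(`) ?t ` R = id ` R"
    by (rule image_cong) (simp_all add: transpose_image_disjoint disj)
  moreover have "?t ` {x, u} = {x, y}" "?t ` {y, w} = {u, w}"
    using ne \<open>x \<noteq> y\<close> \<open>u \<noteq> w\<close> by (auto simp: Transposition.transpose_def)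
  ultimately have "(`) ?t ` insert {x, u} (insert {y, w} R) = insert {x, y} (insert {u, w} R)"
    by simp
  then show "switch x y P = insert {x, y} (insert {partner P x, partner P y} R)"
    using P_eq by (simp add: switch_def u_def w_def)
qed

text \<open>On a tame pair, switching deletes two edges of multiplicity one and creates, besides \<open>xy\<close>, an
  edge of multiplicity one; none of these three is a loop.\<close>

definition tame :: "('h \<Rightarrow> 'v) \<Rightarrow> 'h set set \<Rightarrow> 'h \<Rightarrow> 'h \<Rightarrow> bool" where
  "tame v P x y \<longleftrightarrow>
    v (partner P x) \<notin> {v x, v y} \<and> v (partner P y) \<notin> {v x, v y} \<and>
    v (partner P x) \<noteq> v (partner P y) \<and>
    edge_mult v P {v x, v (partner P x)} = 1 \<and> edge_mult v P {v y, v (partner P y)} = 1 \<and>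
    edge_mult v P {v (partner P x), v (partner P y)} = 0"

locale half_edge_system =
  fixes H :: "'h set" and v :: "'h \<Rightarrow> 'v :: linorder" and V :: "'v set"
  assumes fin_H: "finite H" and fin_V: "finite V" and v_in: "x \<in> H \<Longrightarrow> v x \<in> V"
begin

definition loops :: "'h set set \<Rightarrow> nat" where
  "loops P = (\<Sum>i\<in>V. edge_mult v P {i})"

definition multis :: "'h set set \<Rightarrow> nat" where
  "multis P = (\<Sum>i\<in>V. \<Sum>j\<in>{j\<in>V. i < j}. edge_mult v P {i, j} choose 2)"

text \<open>Tameness makes the vertex pairs of the four edges involved distinct. The two deleted
  edges change a multiplicity from 1 to 0 and the edge between the old partners changes one from 0
  to 1, none of which affects a binomial coefficient over 2. Only \<open>xy\<close> counts: as a
  loop, or, on top of \<open>m\<close> parallel edges, by (m + 1 choose 2) - (m choose 2) =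
  m.\<close>

lemma tame_switch:
  assumes P: "P \<in> perfect_matchings H" and x: "x \<in> H" and y: "y \<in> H" and "x \<noteq> y"
    and tame: "tame v P x y"
  shows "loops (switch x y P) = loops P + of_bool (v x = v y)"
    and "multis (switch x y P) = multis P + (if v x = v y then 0 else edge_mult v P {v x, v y})"
proof -
  define u w where "u = partner P x" and "w = partner P y"
  note t = tame[unfolded tame_def, folded u_def w_def]
  have "partner P x \<noteq> y" using t by (auto simp: u_def)
  with switch_decomposition[OF P x y \<open>x \<noteq> y\<close>, folded u_def w_def]
  obtain R where R: "P = insert {x, u} (insert {y, w} R)"
    "switch x y P = insert {x, y} (insert {u, w} R)"
    "{x, u} \<notin> insert {y, w} R" "{y, w} \<notin> R"
    "{x, y} \<notin> insert {u, w} R" "{u, w} \<notin> R" unfolding u_def by metis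
  have fR: "finite R" using finite_perfect_matching[OF fin_H P] R(1) by auto
  have m: "edge_mult v P f = edge_mult v R f + of_bool ({v x, v u} = f) + of_bool ({v y, v w} = f)" for f
    using R fR by (simp add: edge_mult_insert)
  have m': "edge_mult v (switch x y P) f = edge_mult v R f + of_bool ({v x, v y} = f) + of_bool ({v u, v w} = f)" for f
    using R fR by (simp add: edge_mult_insert)
  have ne: "{v x, v u} \<noteq> {v y, v w}" "{v x, v u} \<noteq> {v x, v y}" "{v x, v u} \<noteq> {v u, v w}"
    "{v y, v w} \<noteq> {v x, v y}" "{v y, v w} \<noteq> {v u, v w}" "{v x, v y} \<noteq> {v u, v w}"
    using t by (auto simp: doubleton_eq_iff)
  have R0: "edge_mult v R {v x, v u} = 0" "edge_mult v R {v y, v w} = 0" "edge_mult v R {v u, v w} = 0"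
    using t m[of "{v x, v u}"] m[of "{v y, v w}"] m[of "{v u, v w}"] ne by auto
  have "edge_mult v (switch x y P) {i} = edge_mult v P {i} + of_bool ({v x, v y} = {i})" for i
    using t by (simp add: m m') auto
  then have "loops (switch x y P) = loops P + (\<Sum>i\<in>V. of_bool ({v x, v y} = {i}))"
    by (simp add: loops_def sum.distrib)
  also have "(\<Sum>i\<in>V. of_bool ({v x, v y} = {i}) :: nat) = (\<Sum>i\<in>V. if v x = i then of_bool (v x = v y) else 0)"
    by (intro sum.cong) auto
  also have "\<dots> = of_bool (v x = v y)" using v_in[OF x] fin_V by simp
  finally show "loops (switch x y P) = loops P + of_bool (v x = v y)" .
  let ?c = "if v x = v y then 0 else edge_mult v P {v x, v y}"
  \<comment> \<open>\<open>multis\<close> runs over \<open>i < j\<close>, so the end points of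
    \<open>xy\<close> have to be put in increasing order.\<close>
  let ?a = "min (v x) (v y)" and ?b = "max (v x) (v y)"
  have "edge_mult v (switch x y P) {i, j} choose 2 =
      (edge_mult v P {i, j} choose 2) + (if ?a = i then if ?b = j then ?c else 0 else 0)"
    if "i < j" for i j
  proof -
    consider "{i, j} = {v x, v u}" | "{i, j} = {v y, v w}" | "{i, j} = {v u, v w}"
      | "{i, j} = {v x, v y}" | "{i, j} \<notin> {{v x, v u}, {v y, v w}, {v u, v w}, {v x, v y}}" by auto
    note cases = this
    have eq: "{i, j} = {v x, v y} \<longleftrightarrow> ?a = i \<and> ?b = j \<and> v x \<noteq> v y"
      using that by (auto simp: doubleton_eq_iff min_def max_def)
    have eq': "(if ?a = i then if ?b = j then ?c else 0 else 0) =
        (if {i, j} = {v x, v y} then edge_mult v P {v x, v y} else 0)"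
      unfolding eq by auto
    have "edge_mult v (switch x y P) {i, j} choose 2 = (edge_mult v P {i, j} choose 2) +
        (if {i, j} = {v x, v y} then edge_mult v P {v x, v y} else 0)"
    proof (cases rule: cases)
      case 1
      then show ?thesis using ne ne[symmetric] by (simp add: m m' R0 numeral_2_eq_2)
    next
      case 2
      then show ?thesis using ne ne[symmetric] by (simp add: m m' R0 numeral_2_eq_2)
    next
      case 3
      then show ?thesis using ne ne[symmetric] by (simp add: m m' R0 numeral_2_eq_2)
    next
      case 4
      then show ?thesis using ne ne[symmetric] by (simp add: m m' numeral_2_eq_2)
    next
      case 5
      then show ?thesis by (simp add: m m' eq_commute[of "{i, j}"])
    qed
    then show ?thesis unfolding eq' .
  qed
  then have "multis (switch x y P) = multis P +
      (\<Sum>i\<in>V. \<Sum>j\<in>{j\<in>V. i < j}. if ?a = i then if ?b = j then ?c else 0 else 0)"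
    by (simp add: multis_def sum.distrib)
  also have "(\<Sum>i\<in>V. \<Sum>j\<in>{j\<in>V. i < j}. if ?a = i then if ?b = j then ?c else 0 else 0) =
      (\<Sum>i\<in>V. if ?a = i then (\<Sum>j\<in>{j\<in>V. ?a < j}. if ?b = j then ?c else 0) else 0)"
    by (intro sum.cong) auto
  also have "\<dots> = ?c"
    using v_in[OF x] v_in[OF y] fin_V by (auto simp: min_def max_def)
  finally show "multis (switch x y P) = multis P + ?c" .
qed

text \<open>Pairs are ordered, so that a loop arises from two elements of \<open>loop_pairs\<close>, and a pair of
  parallel edges \<open>xy\<close>, \<open>x'y'\<close> from four elements \<open>((x, x'), (y, y'))\<close> of \<open>double_pairs\<close>.\<close>

definition loop_pairs :: "('h \<times> 'h) set" where
  "loop_pairs = {(x, y) \<in> H \<times> H. x \<noteq> y \<and> v x = v y}"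

definition double_pairs :: "(('h \<times> 'h) \<times> ('h \<times> 'h)) set" where
  "double_pairs = {(p, q) \<in> loop_pairs \<times> loop_pairs. v (fst p) \<noteq> v (fst q)}"

section \<open>Counting loops and parallel edges by ordered half-edges\<close>

lemma card_oriented_edges:
  assumes P: "P \<in> perfect_matchings H"
  shows "finite {(x, y). {x, y} \<in> P \<and> v x = i \<and> v y = j}"
    and "card {(x, y). {x, y} \<in> P \<and> v x = i \<and> v y = j} = (if i = j then 2 else 1) * edge_mult v P {i, j}"
proof -
  let ?E = "{e \<in> P. v ` e = {i, j}}"
  let ?o = "\<lambda>e. {(x, y). {x, y} = e \<and> v x = i \<and> v y = j}"
  have eq: "{(x, y). {x, y} \<in> P \<and> v x = i \<and> v y = j} = (\<Union>e\<in>?E. ?o e)" by auto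
  have fE: "finite ?E" using finite_perfect_matching[OF fin_H P] by auto
  have c: "finite (?o e) \<and> card (?o e) = (if i = j then 2 else 1)" if "e \<in> ?E" for e
  proof -
    from that P obtain a b where e: "e = {a, b}" "a \<noteq> b"
      by (auto simp: perfect_matchings_def card_2_iff)
    then have "{v a, v b} = {i, j}" using that by auto
    \<comment> \<open>A loop can be read in both directions. For distinct vertices the requirement
      that the first half-edge lie at \<open>i\<close> fixes the direction.\<close>
    then consider "i = j" "v a = i" "v b = i" | "i \<noteq> j" "v a = i" "v b = j" | "i \<noteq> j" "v a = j" "v b = i"
      by (auto simp: doubleton_eq_iff)
    then show ?thesis
    proof cases
      case 1
      then have "?o e = {(a, b), (b, a)}" using e by (auto simp: doubleton_eq_iff)
      then show ?thesis using 1 e by simp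
    next
      case 2
      then have "?o e = {(a, b)}" using e by (auto simp: doubleton_eq_iff)
      then show ?thesis using 2 by simp
    next
      case 3
      then have "?o e = {(b, a)}" using e by (auto simp: doubleton_eq_iff)
      then show ?thesis using 3 by simp
    qed
  qed
  show "finite {(x, y). {x, y} \<in> P \<and> v x = i \<and> v y = j}"
    unfolding eq using fE c by auto
  have "card (\<Union>e\<in>?E. ?o e) = (\<Sum>e\<in>?E. card (?o e))"
    by (rule card_UN_disjoint) (use fE c in auto)
  also have "\<dots> = (\<Sum>e\<in>?E. if i = j then 2 else 1)" using c by (intro sum.cong) auto
  finally show "card {(x, y). {x, y} \<in> P \<and> v x = i \<and> v y = j} =
      (if i = j then 2 else 1) * edge_mult v P {i, j}"
    unfolding eq by (simp add: edge_mult_def)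
qed

lemma finite_pairs: "finite loop_pairs" "finite double_pairs"
proof -
  show "finite loop_pairs"
    by (rule finite_subset[of _ "H \<times> H"]) (use fin_H in \<open>auto simp: loop_pairs_def\<close>)
  then show "finite double_pairs"
    by (intro finite_subset[of double_pairs "loop_pairs \<times> loop_pairs"]) (auto simp: double_pairs_def)
qed

lemma loops_eq_card:
  assumes P: "P \<in> perfect_matchings H"
  shows "card {(x, y) \<in> loop_pairs. {x, y} \<in> P} = 2 * loops P"
proof -
  let ?O = "\<lambda>i. {(x, y). {x, y} \<in> P \<and> v x = i \<and> v y = i}"
  have eq: "{(x, y) \<in> loop_pairs. {x, y} \<in> P} = (\<Union>i\<in>V. ?O i)"
    using perfect_matchings_edge[OF P] v_in by (fastforce simp: loop_pairs_def)
  have "card (\<Union>i\<in>V. ?O i) = (\<Sum>i\<in>V. card (?O i))"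
    by (rule card_UN_disjoint) (use fin_V card_oriented_edges[OF P] in auto)
  then show ?thesis
    unfolding eq using card_oriented_edges(2)[OF P] by (simp add: loops_def sum_distrib_left)
qed

lemma card_distinct_pairs:
  assumes "finite A"
  shows "card {(p, q) \<in> A \<times> A. p \<noteq> q} = 2 * (card A choose 2)"
proof -
  have "{(p, q) \<in> A \<times> A. p \<noteq> q} = (SIGMA p:A. A - {p})" by auto
  then have "card {(p, q) \<in> A \<times> A. p \<noteq> q} = (\<Sum>p\<in>A. card (A - {p}))"
    using assms by (simp add: card_SigmaI)
  also have "\<dots> = card A * (card A - 1)" using assms by simp
  finally have c: "card {(p, q) \<in> A \<times> A. p \<noteq> q} = card A * (card A - 1)" .
  have "even (card A * (card A - 1))" by (cases "card A") auto
  then show ?thesis unfolding c choose_two by (rule dvd_mult_div_cancel[symmetric])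
qed

text \<open>Regrouped as \<open>((x, y), (x', y'))\<close>, such a tuple is an ordered pair of
  distinct edges, both directed from one vertex \<open>i\<close> to another vertex \<open>j\<close>.
  One factor 2 is the order of the edges, the other the exchange of \<open>i\<close> and
  \<open>j\<close>.\<close>

lemma multis_eq_card:
  assumes P: "P \<in> perfect_matchings H"
  shows "card {((x, x'), (y, y')) \<in> double_pairs. {x, y} \<in> P \<and> {x', y'} \<in> P} = 4 * multis P"
proof -
  let ?O = "\<lambda>i j. {(x, y). {x, y} \<in> P \<and> v x = i \<and> v y = j}"
  let ?D = "\<lambda>(i, j). {(p, q) \<in> ?O i j \<times> ?O i j. p \<noteq> q}"
  let ?T = "{((x, x'), (y, y')) \<in> double_pairs. {x, y} \<in> P \<and> {x', y'} \<in> P}"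
  let ?I = "{(i, j) \<in> V \<times> V. i \<noteq> j}"
  let ?c = "\<lambda>i j. edge_mult v P {i, j} choose 2"
  have fin: "finite (?O i j)" for i j using card_oriented_edges[OF P] by blast
  \<comment> \<open>Distinct edges differ at both ends, as membership in \<open>double_pairs\<close>
    demands, because a half-edge determines its partner.\<close>
  have uniq: "x = x' \<longleftrightarrow> y = y'" if "{x, y} \<in> P" "{x', y'} \<in> P" for x x' y y'
    using that partner_eq[OF P] by (metis insert_commute)
  have "bij_betw (\<lambda>((x, x'), (y, y')). ((x, y), (x', y'))) ?T (\<Union>ij\<in>?I. ?D ij)"
  proof (rule bij_betw_byWitness[where f' = "\<lambda>((x, y), (x', y')). ((x, x'), (y, y'))"])
    show "(\<lambda>((x, x'), (y, y')). ((x, y), (x', y'))) ` ?T \<subseteq> (\<Union>ij\<in>?I. ?D ij)"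
      using v_in by (auto simp: double_pairs_def loop_pairs_def)
    show "(\<lambda>((x, y), (x', y')). ((x, x'), (y, y'))) ` (\<Union>ij\<in>?I. ?D ij) \<subseteq> ?T"
    proof
      fix t assume "t \<in> (\<lambda>((x, y), (x', y')). ((x, x'), (y, y'))) ` (\<Union>ij\<in>?I. ?D ij)"
      then obtain x x' y y' where t: "t = ((x, x'), (y, y'))" and
        *: "{x, y} \<in> P" "{x', y'} \<in> P" "v x' = v x" "v y' = v y" "v x \<noteq> v y" "x = x' \<longrightarrow> y \<noteq> y'"
        by auto
      then show "t \<in> ?T"
        using uniq[OF *(1,2)] perfect_matchings_edge[OF P *(1)] perfect_matchings_edge[OF P *(2)]
        by (auto simp: double_pairs_def loop_pairs_def)
    qed
  qed auto
  then have "card ?T = card (\<Union>ij\<in>?I. ?D ij)" by (rule bij_betw_same_card)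
  also have "\<dots> = (\<Sum>ij\<in>?I. card (?D ij))"
  proof (rule card_UN_disjoint)
    show "finite ?I" by (rule finite_subset[of _ "V \<times> V"]) (use fin_V in auto)
    show "\<forall>ij\<in>?I. finite (?D ij)"
      using fin by (auto intro!: finite_subset[OF _ finite_cartesian_product[OF fin fin]])
    show "\<forall>ij\<in>?I. \<forall>kl\<in>?I. ij \<noteq> kl \<longrightarrow> ?D ij \<inter> ?D kl = {}" by auto
  qed
  also have "\<dots> = (\<Sum>(i, j)\<in>?I. 2 * ?c i j)"
  proof (rule sum.cong[OF refl])
    fix ij assume "ij \<in> ?I"
    then obtain i j where ij: "ij = (i, j)" "i \<noteq> j" by auto
    then show "card (?D ij) = (case ij of (i, j) \<Rightarrow> 2 * ?c i j)"
      using card_distinct_pairs[OF fin] card_oriented_edges(2)[OF P] by simp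
  qed
  also have "\<dots> = (\<Sum>(i, j)\<in>{(i, j) \<in> V \<times> V. i < j}. 2 * ?c i j) + (\<Sum>(i, j)\<in>{(i, j) \<in> V \<times> V. j < i}. 2 * ?c i j)"
    by (subst sum.union_disjoint[symmetric]) (auto intro!: sum.cong finite_subset[OF _ finite_cartesian_product[OF fin_V fin_V]])
  also have "(\<Sum>(i, j)\<in>{(i, j) \<in> V \<times> V. j < i}. 2 * ?c i j) = (\<Sum>(i, j)\<in>{(i, j) \<in> V \<times> V. i < j}. 2 * ?c i j)"
    by (rule sum.reindex_bij_witness[where i = prod.swap and j = prod.swap]) (auto simp: insert_commute)
  also have "{(i, j) \<in> V \<times> V. i < j} = (SIGMA i:V. {j\<in>V. i < j})" by auto
  also have "(\<Sum>(i, j)\<in>(SIGMA i:V. {j\<in>V. i < j}). 2 * ?c i j) = 2 * multis P"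
    using fin_V by (simp add: sum.Sigma[symmetric] multis_def sum_distrib_left)
  finally show ?thesis by simp
qed

end

section \<open>Probability of exceptional switches\<close>

lemma card_UN_le_real:
  assumes "finite I" "\<And>i. i \<in> I \<Longrightarrow> real (card (A i)) \<le> c"
  shows "real (card (\<Union>i\<in>I. A i)) \<le> real (card I) * c"
proof -
  have "real (card (\<Union>i\<in>I. A i)) \<le> (\<Sum>i\<in>I. real (card (A i)))"
    using card_UN_le[OF assms(1), of A] by (simp flip: of_nat_sum)
  also have "\<dots> \<le> real (card I) * c"
    using assms(2) by (rule sum_bounded_above)
  finally show ?thesis .
qed

lemma perfect_matchings_edge_oriented:
  assumes P: "P \<in> perfect_matchings H" and "e \<in> P" "v ` e = {i, j}"
  obtains a b where "e = {a, b}" "v a = i" "v b = j"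
proof -
  from assms obtain a b where "e = {a, b}" by (auto simp: perfect_matchings_def card_2_iff)
  with assms(3) that[of a b] that[of b a] show thesis by (auto simp: doubleton_eq_iff)
qed

text \<open>A vertex of degree \<open>k\<close> contributes \<open>k\<close> half-edges, each with a
  class of size \<open>k\<close>. So \<open>sum_deg_le\<close> bounds the sum of squared degrees by
  a multiple of the sum of degrees, and its 2 cancels against the one in \<open>r\<close>.\<close>

locale bounded_half_edge_system = half_edge_system H v V
  for H :: "'h set" and v :: "'h \<Rightarrow> 'v :: linorder" and V +
  fixes \<Delta> K :: real
  assumes card_H: "card H \<ge> 14"
    and deg_le: "x \<in> H \<Longrightarrow> real (card {z \<in> H. v z = v x}) \<le> \<Delta>"
    and sum_deg_le: "(\<Sum>x\<in>H. real (card {z \<in> H. v z = v x})) \<le> K * card H / 2"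
begin

section \<open>Union bounds over forced edges\<close>

definition cls :: "'h \<Rightarrow> 'h set" where
  "cls x = {z \<in> H. v z = v x}"

text \<open>A uniform bound for the probability of one more prescribed edge, given at most three
  forced ones.\<close>

definition r :: real where "r = 2 / real (card H)"

abbreviation "N B \<equiv> real (card (matchings_with H B))"

lemma r_pos: "0 < r" using card_H by (simp add: r_def)

lemma finite_cls [simp, intro]: "finite (cls x)" using fin_H by (simp add: cls_def)

lemma cls_le: "x \<in> H \<Longrightarrow> real (card (cls x)) \<le> \<Delta>"
  using deg_le by (simp add: cls_def)

lemma Delta_ge_1: "1 \<le> \<Delta>"
proof -
  obtain x where x: "x \<in> H" using card_H by fastforce
  then have "card (cls x) \<noteq> 0" by (auto simp: cls_def fin_H)
  then have "1 \<le> real (card (cls x))" by linarith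
  then show ?thesis using cls_le[OF x] by linarith
qed

lemma sum_cls_le: "r * (\<Sum>x\<in>H. real (card (cls x))) \<le> K"
  using sum_deg_le card_H by (simp add: r_def cls_def field_simps)

lemma K_nonneg: "0 \<le> K"
  using sum_cls_le r_pos by (meson mult_nonneg_nonneg less_imp_le of_nat_0_le_iff order_trans sum_nonneg)

lemma N_insert:
  assumes "x \<notin> \<Union>B" "card B \<le> 3"
  shows "N (insert {x, u} B) \<le> r * N B"
  using card_matchings_with_insert[OF fin_H assms card_H] by (simp add: r_def)

lemma N_insert2:
  assumes "x \<notin> \<Union>B" "a \<notin> \<Union>(insert {x, u} B)" "card B \<le> 2"
  shows "N (insert {a, b} (insert {x, u} B)) \<le> r\<^sup>2 * N B"
proof -
  have "card (insert {x, u} B) \<le> 3" using assms(3) card_insert_le_m1[of 3 B "{x, u}"] by simp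
  from N_insert[OF assms(2) this, of b]
  have "N (insert {a, b} (insert {x, u} B)) \<le> r * N (insert {x, u} B)" .
  also have "\<dots> \<le> r * (r * N B)"
    using N_insert[OF assms(1), of u] assms(3) r_pos by (intro mult_left_mono) auto
  finally show ?thesis by (simp add: power2_eq_square)
qed

lemma N_insert3:
  assumes "x \<notin> \<Union>B" "y \<notin> \<Union>(insert {x, u} B)" "a \<notin> \<Union>(insert {y, w} (insert {x, u} B))" "card B \<le> 1"
  shows "N (insert {a, b} (insert {y, w} (insert {x, u} B))) \<le> r ^ 3 * N B"
proof -
  have "card (insert {x, u} B) \<le> 2" using assms(4) card_insert_le_m1[of 2 B "{x, u}"] by simp
  from N_insert2[OF assms(2,3) this, of b]
  have "N (insert {a, b} (insert {y, w} (insert {x, u} B))) \<le> r\<^sup>2 * N (insert {x, u} B)" .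
  also have "\<dots> \<le> r\<^sup>2 * (r * N B)"
    using N_insert[OF assms(1), of u] assms(4) r_pos by (intro mult_left_mono) auto
  finally show ?thesis by (simp add: power2_eq_square power3_eq_cube)
qed

lemma finite_matchings_with: "finite (matchings_with H B)"
  using finite_perfect_matchings[OF fin_H] by (auto simp: matchings_with_def)

text \<open>The sum of the squared degrees, or equally the number of ordered pairs of half-edges at
  a common vertex. In the union bounds each factor \<open>m2\<close> is paid for by a factor
  \<open>r\<close>.\<close>

definition m2 :: real where "m2 = (\<Sum>x\<in>H. real (card (cls x)))"

lemma m2_nonneg: "0 \<le> m2" by (simp add: m2_def sum_nonneg)

lemma r_m2: "r * m2 \<le> K" using sum_cls_le by (simp add: m2_def)

lemma card_Sigma_cls: "real (card (Sigma H cls)) = m2" "finite (Sigma H cls)"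
  using fin_H by (auto simp: m2_def)

text \<open>The edge of \<open>x\<close> has a parallel edge. Partners at the vertices of
  \<open>x\<close> and \<open>y\<close> are left out because they are counted separately, and
  because then no forced edge can be the parallel one.\<close>

definition rivals :: "'h set set \<Rightarrow> 'h \<Rightarrow> 'h \<Rightarrow> 'h set set set" where
  "rivals B x y = {P \<in> matchings_with H B.
     v (partner P x) \<notin> {v x, v y} \<and> edge_mult v P {v x, v (partner P x)} \<noteq> 1}"

lemma edge_mult_neq_1D:
  assumes P: "P \<in> perfect_matchings H" and e: "e \<in> P" and "edge_mult v P (v ` e) \<noteq> 1"
  obtains e' where "e' \<in> P" "e' \<noteq> e" "v ` e' = v ` e"
proof -
  have "{e' \<in> P. v ` e' = v ` e} \<noteq> {e}" using assms(3) by (auto simp: edge_mult_def)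
  then show thesis using that e by blast
qed

text \<open>Let \<open>u\<close> be the partner of \<open>x\<close> and \<open>ab\<close> the
  parallel edge. There are at most \<open>\<Delta>\<close> choices for \<open>a\<close> at the
  vertex of \<open>x\<close> and \<open>m2\<close> choices for \<open>u\<close>, \<open>b\<close> at
  a common vertex, and two edges are forced beyond \<open>B\<close>.\<close>

lemma card_rivals_le:
  assumes x: "x \<in> H" and y: "y \<in> H"
    and xB: "x \<notin> \<Union>B" and cB: "card B \<le> 1" and B: "\<And>e. e \<in> B \<Longrightarrow> v ` e = {v x, v y}"
  shows "real (card (rivals B x y)) \<le> \<Delta> * m2 * r\<^sup>2 * N B"
proof -
  define I where "I = {(a, u, b) \<in> cls x \<times> Sigma H cls. a \<notin> \<Union>(insert {x, u} B)}"
  let ?A = "\<lambda>(a, u, b). matchings_with H (insert {a, b} (insert {x, u} B))"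
  have I: "I \<subseteq> cls x \<times> Sigma H cls" by (auto simp: I_def)
  have fI: "finite I" by (rule finite_subset[OF I]) (use card_Sigma_cls in simp)
  have "rivals B x y \<subseteq> (\<Union>i\<in>I. ?A i)"
  proof
    fix P assume "P \<in> rivals B x y"
    then have P: "P \<in> perfect_matchings H" "B \<subseteq> P" and u: "v (partner P x) \<notin> {v x, v y}"
      and m: "edge_mult v P {v x, v (partner P x)} \<noteq> 1" by (auto simp: rivals_def matchings_with_def)
    define u where "u = partner P x"
    have xu: "{x, u} \<in> P" using partner_edge[OF P(1) x] by (simp add: u_def)
    have "edge_mult v P (v ` {x, u}) \<noteq> 1" using m by (simp add: u_def)
    from edge_mult_neq_1D[OF P(1) xu this] obtain e where e: "e \<in> P" "e \<noteq> {x, u}" "v ` e = {v x, v u}"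
      by auto
    obtain a b where ab: "e = {a, b}" "v a = v x" "v b = v u"
      using perfect_matchings_edge_oriented[OF P(1) e(1,3)] .
    have "a \<noteq> x" using perfect_matchings_unique[OF P(1) e(1) xu, of x] ab e by auto
    moreover have "a \<noteq> u" using ab u by (auto simp: u_def)
    moreover have "a \<notin> e'" if "e' \<in> B" for e'
    proof
      assume "a \<in> e'"
      then have "e' = e" using perfect_matchings_unique[OF P(1) _ e(1), of e' a] that P ab by auto
      then have "{v x, v u} = {v x, v y}" using B[OF that] e by simp
      then show False using u by (auto simp: u_def doubleton_eq_iff)
    qed
    ultimately have "(a, u, b) \<in> I"
      using ab perfect_matchings_edge[OF P(1)] e(1) xu by (auto simp: I_def cls_def)
    moreover have "P \<in> ?A (a, u, b)" using P e xu ab by (auto simp: matchings_with_def)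
    ultimately show "P \<in> (\<Union>i\<in>I. ?A i)" by blast
  qed
  then have "real (card (rivals B x y)) \<le> real (card (\<Union>i\<in>I. ?A i))"
    using fI finite_matchings_with by (intro of_nat_mono card_mono) auto
  also have "\<dots> \<le> real (card I) * (r\<^sup>2 * N B)"
  proof (rule card_UN_le_real[OF fI])
    fix i assume "i \<in> I"
    then show "real (card (?A i)) \<le> r\<^sup>2 * N B"
      using N_insert2[OF xB] cB by (auto simp: I_def)
  qed
  also have "real (card I) \<le> \<Delta> * m2"
  proof -
    have "real (card I) \<le> real (card (cls x \<times> Sigma H cls))"
      using I card_Sigma_cls by (intro of_nat_mono card_mono) auto
    also have "\<dots> = real (card (cls x)) * m2" by (simp only: card_cartesian_product of_nat_mult card_Sigma_cls)
    also have "\<dots> \<le> \<Delta> * m2" using cls_le[OF x] m2_nonneg by (rule mult_right_mono)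
    finally show ?thesis .
  qed
  finally show ?thesis by (simp add: mult_right_mono mult_ac)
qed

text \<open>Adds up the costs in units of \<open>r * \<Delta>\<close>: 4 for a partner of
  \<open>x\<close> or \<open>y\<close> at one of their two vertices; \<open>3 * K\<close> for
  partners at a common vertex and for a parallel edge at \<open>x\<close> or at \<open>y\<close>;
  \<open>K\<^sup>2\<close> for an edge already joining the vertices of the partners.\<close>

definition \<kappa> :: real where "\<kappa> = 4 + 3 * K + K\<^sup>2"

text \<open>A union bound over the ways tameness can fail, each forcing one to three further edges.
  Since a forced edge joins the vertices of \<open>x\<close> and \<open>y\<close>, it can never be
  the edge that spoils tameness.\<close>

lemma card_not_tame_le:
  assumes x: "x \<in> H" and y: "y \<in> H" and "x \<noteq> y" and xB: "x \<notin> \<Union>B" and yB: "y \<notin> \<Union>B"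
    and cB: "card B \<le> 1" and B: "\<And>e. e \<in> B \<Longrightarrow> v ` e = {v x, v y}"
  shows "real (card {P \<in> matchings_with H B. \<not> tame v P x y}) \<le> \<kappa> * r * \<Delta> * N B"
proof -
  let ?M = "\<lambda>B. matchings_with H B"
  define A1 where "A1 = (\<Union>u\<in>cls x \<union> cls y. ?M (insert {x, u} B))"
  define A2 where "A2 = (\<Union>w\<in>cls x \<union> cls y. ?M (insert {y, w} B))"
  \<comment> \<open>The case \<open>u = y\<close> already belongs to \<open>A1\<close>; excluding it
    leaves \<open>y\<close> free when the edge of \<open>y\<close> is forced after that of
    \<open>x\<close>.\<close>
  define I3 where "I3 = {(u, w) \<in> Sigma H cls. u \<noteq> y}"
  define A3 where "A3 = (\<Union>(u, w)\<in>I3. ?M (insert {y, w} (insert {x, u} B)))"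
  define I4 where "I4 = {((u, a), (w, b)) \<in> Sigma H cls \<times> Sigma H cls.
     y \<notin> \<Union>(insert {x, u} B) \<and> a \<notin> \<Union>(insert {y, w} (insert {x, u} B))}"
  define A4 where "A4 = (\<Union>((u, a), (w, b))\<in>I4. ?M (insert {a, b} (insert {y, w} (insert {x, u} B))))"
  note defs = A1_def A2_def A3_def A4_def
  have fin: "finite I3" "finite I4"
    by (rule finite_subset[of _ "Sigma H cls"], auto simp: I3_def card_Sigma_cls)
      (rule finite_subset[of _ "Sigma H cls \<times> Sigma H cls"], auto simp: I4_def card_Sigma_cls)
  have sub: "{P \<in> ?M B. \<not> tame v P x y} \<subseteq> A1 \<union> A2 \<union> A3 \<union> rivals B x y \<union> rivals B y x \<union> A4"
  proof
    fix P assume "P \<in> {P \<in> ?M B. \<not> tame v P x y}"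
    then have PB: "P \<in> ?M B" and P: "P \<in> perfect_matchings H" "B \<subseteq> P" and nt: "\<not> tame v P x y"
      by (auto simp: matchings_with_def)
    define u w where "u = partner P x" and "w = partner P y"
    have xu: "{x, u} \<in> P" and yw: "{y, w} \<in> P"
      using partner_edge[OF P(1)] x y by (simp_all add: u_def w_def)
    note H = perfect_matchings_edge[OF P(1) xu] perfect_matchings_edge[OF P(1) yw]
    show "P \<in> A1 \<union> A2 \<union> A3 \<union> rivals B x y \<union> rivals B y x \<union> A4"
    proof (cases "v u \<in> {v x, v y} \<or> v w \<in> {v x, v y}")
      case True
      then have "P \<in> A1 \<or> P \<in> A2"
        using P H xu yw by (auto simp: A1_def A2_def matchings_with_def cls_def)
      then show ?thesis by auto
    next
      case uw: False
      then have uy: "u \<noteq> y" by auto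
      consider "v u = v w" | "edge_mult v P {v x, v u} \<noteq> 1" | "edge_mult v P {v y, v w} \<noteq> 1"
        | "v u \<noteq> v w" "edge_mult v P {v u, v w} \<noteq> 0"
        using nt uw unfolding tame_def u_def w_def by auto
      then show ?thesis
      proof cases
        case 1
        then have "(u, w) \<in> I3" using H uy by (auto simp: I3_def cls_def)
        then have "P \<in> A3" using P xu yw by (auto simp: A3_def matchings_with_def)
        then show ?thesis by auto
      next
        case 2
        then have "P \<in> rivals B x y" using PB uw by (auto simp: rivals_def u_def)
        then show ?thesis by auto
      next
        case 3
        then have "P \<in> rivals B y x" using PB uw by (auto simp: rivals_def w_def)
        then show ?thesis by auto
      next
        case 4
        then have "{e \<in> P. v ` e = {v u, v w}} \<noteq> {}" unfolding edge_mult_def by (metis card.empty)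
        then obtain e where e: "e \<in> P" "v ` e = {v u, v w}" by auto
        obtain a b where ab: "e = {a, b}" "v a = v u" "v b = v w"
          using perfect_matchings_edge_oriented[OF P(1) e] .
        have "a \<noteq> x" "a \<noteq> y" "a \<noteq> w" using ab uw 4 by auto
        moreover have "a \<noteq> u"
        proof
          assume "a = u"
          then have "e = {x, u}" using perfect_matchings_unique[OF P(1) e(1) xu, of u] ab by auto
          then have "v x \<in> {v u, v w}" using e(2) by auto
          then show False using uw by auto
        qed
        moreover have "a \<notin> e'" if "e' \<in> B" for e'
        proof
          assume "a \<in> e'"
          then have "e' = e" using perfect_matchings_unique[OF P(1) _ e(1), of e' a] that P ab by auto
          then have "{v u, v w} = {v x, v y}" using B[OF that] e by simp
          then show False using uw by (auto simp: doubleton_eq_iff)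
        qed
        ultimately have i: "((u, a), (w, b)) \<in> I4"
          using ab perfect_matchings_edge[OF P(1)] e(1) H uy yB \<open>x \<noteq> y\<close>
          by (auto simp: I4_def cls_def)
        have "P \<in> ?M (insert {a, b} (insert {y, w} (insert {x, u} B)))"
          using P e xu yw ab by (auto simp: matchings_with_def)
        then have "P \<in> A4" unfolding A4_def by (intro UN_I[OF i]) simp
        then show ?thesis by auto
      qed
    qed
  qed
  have c: "real (card (cls x \<union> cls y)) \<le> 2 * \<Delta>"
    using cls_le[OF x] cls_le[OF y] card_Un_le[of "cls x" "cls y"] by linarith
  have 1: "real (card A1) \<le> 2 * \<Delta> * (r * N B)"
  proof -
    have "real (card A1) \<le> real (card (cls x \<union> cls y)) * (r * N B)"
      unfolding A1_def by (rule card_UN_le_real) (use N_insert xB cB in auto)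
    also have "\<dots> \<le> 2 * \<Delta> * (r * N B)" using c r_pos by (intro mult_right_mono) auto
    finally show ?thesis .
  qed
  have 2: "real (card A2) \<le> 2 * \<Delta> * (r * N B)"
  proof -
    have "real (card A2) \<le> real (card (cls x \<union> cls y)) * (r * N B)"
      unfolding A2_def by (rule card_UN_le_real) (use N_insert yB cB in auto)
    also have "\<dots> \<le> 2 * \<Delta> * (r * N B)" using c r_pos by (intro mult_right_mono) auto
    finally show ?thesis .
  qed
  have 3: "real (card A3) \<le> m2 * (r\<^sup>2 * N B)"
  proof -
    have "real (card A3) \<le> real (card I3) * (r\<^sup>2 * N B)"
      unfolding A3_def
    proof (rule card_UN_le_real[OF fin(1)])
      fix i assume "i \<in> I3"
      then obtain u w where i: "i = (u, w)" "u \<noteq> y" by (auto simp: I3_def)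
      then have "y \<notin> \<Union>(insert {x, u} B)" using yB \<open>x \<noteq> y\<close> by auto
      then show "real (card (case i of (u, w) \<Rightarrow> ?M (insert {y, w} (insert {x, u} B)))) \<le> r\<^sup>2 * N B"
        using N_insert2[OF xB] cB i by auto
    qed
    also have "\<dots> \<le> m2 * (r\<^sup>2 * N B)"
      unfolding card_Sigma_cls(1)[symmetric]
      by (intro mult_right_mono of_nat_mono card_mono card_Sigma_cls) (auto simp: I3_def)
    finally show ?thesis .
  qed
  have 4: "real (card A4) \<le> m2\<^sup>2 * (r ^ 3 * N B)"
  proof -
    have "real (card A4) \<le> real (card I4) * (r ^ 3 * N B)"
      unfolding A4_def
    proof (rule card_UN_le_real[OF fin(2)])
      fix i assume i: "i \<in> I4"
      then show "real (card ((\<lambda>((u, a), (w, b)). ?M (insert {a, b} (insert {y, w} (insert {x, u} B)))) i)) \<le> r ^ 3 * N B"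
        using N_insert3[OF xB] cB by (auto simp: I4_def)
    qed
    also have "real (card I4) \<le> real (card (Sigma H cls \<times> Sigma H cls))"
      by (intro of_nat_mono card_mono finite_cartesian_product card_Sigma_cls) (auto simp: I4_def)
    also have "\<dots> = m2\<^sup>2" by (simp only: card_cartesian_product of_nat_mult card_Sigma_cls power2_eq_square)
    finally show ?thesis using r_pos by (simp add: mult_right_mono)
  qed
  have 5: "real (card (rivals B x y)) \<le> \<Delta> * m2 * r\<^sup>2 * N B"
    by (rule card_rivals_le) (use assms in auto)
  have 6: "real (card (rivals B y x)) \<le> \<Delta> * m2 * r\<^sup>2 * N B"
    by (rule card_rivals_le) (use assms in \<open>auto simp: insert_commute\<close>)
  have f: "finite (A1 \<union> A2 \<union> A3 \<union> rivals B x y \<union> rivals B y x \<union> A4)"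
    using fin finite_matchings_with by (auto simp: defs rivals_def)
  have "real (card {P \<in> ?M B. \<not> tame v P x y}) \<le> real (card (A1 \<union> A2 \<union> A3 \<union> rivals B x y \<union> rivals B y x \<union> A4))"
    by (intro of_nat_mono card_mono f sub)
  also have "\<dots> \<le> real (card A1 + card A2 + card A3 + card (rivals B x y) + card (rivals B y x) + card A4)"
    by (intro of_nat_mono order_trans[OF card_Un_le] add_right_mono) simp
  also have "\<dots> \<le> (4 * \<Delta> * r + m2 * r\<^sup>2 + 2 * \<Delta> * m2 * r\<^sup>2 + m2\<^sup>2 * r ^ 3) * N B"
    using 1 2 3 4 5 6 by (simp add: algebra_simps)
  also have "\<dots> \<le> (\<kappa> * r * \<Delta>) * N B"
  proof (rule mult_right_mono)
    have "m2 * r\<^sup>2 = (r * m2) * r" by (simp add: power2_eq_square)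
    also have "\<dots> \<le> K * r" using r_m2 r_pos by (intro mult_right_mono) auto
    finally have a: "m2 * r\<^sup>2 \<le> K * r" .
    have b: "K * r \<le> K * r * \<Delta>"
      using Delta_ge_1 mult_left_mono[of 1 \<Delta> "K * r"] K_nonneg r_pos by simp
    have c: "\<Delta> * (m2 * r\<^sup>2) \<le> \<Delta> * (K * r)" using a Delta_ge_1 by (intro mult_left_mono) auto
    have "m2\<^sup>2 * r ^ 3 = (r * m2)\<^sup>2 * r" by (simp add: power2_eq_square power3_eq_cube)
    also have "\<dots> \<le> K\<^sup>2 * r" using r_m2 r_pos m2_nonneg by (intro mult_right_mono power_mono) auto
    also have "\<dots> \<le> K\<^sup>2 * r * \<Delta>"
      using Delta_ge_1 mult_left_mono[of 1 \<Delta> "K\<^sup>2 * r"] r_pos by simp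
    finally have d: "m2\<^sup>2 * r ^ 3 \<le> K\<^sup>2 * r * \<Delta>" .
    show "4 * \<Delta> * r + m2 * r\<^sup>2 + 2 * \<Delta> * m2 * r\<^sup>2 + m2\<^sup>2 * r ^ 3 \<le> \<kappa> * r * \<Delta>"
      using a b c d by (simp add: \<kappa>_def algebra_simps)
  qed simp
  finally show ?thesis .
qed

text \<open>An edge outside \<open>B\<close> between the two vertices is determined by one half-edge
  at each of them, and it costs one forced edge. This is where \<open>\<Delta>\<^sup>2\<close>
  enters the switching error.\<close>

lemma card_parallel_le:
  assumes x: "x \<in> H" and y: "y \<in> H" and cB: "card B \<le> 1"
  shows "real (card {P \<in> matchings_with H B. \<exists>e\<in>P - B. v ` e = {v x, v y}}) \<le> \<Delta>\<^sup>2 * r * N B"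
proof -
  define I where "I = {(a, b) \<in> cls x \<times> cls y. a \<notin> \<Union>B}"
  let ?A = "\<lambda>(a, b). matchings_with H (insert {a, b} B)"
  have I: "I \<subseteq> cls x \<times> cls y" by (auto simp: I_def)
  have fI: "finite I" by (rule finite_subset[OF I]) simp
  have "{P \<in> matchings_with H B. \<exists>e\<in>P - B. v ` e = {v x, v y}} \<subseteq> (\<Union>i\<in>I. ?A i)"
  proof
    fix P assume "P \<in> {P \<in> matchings_with H B. \<exists>e\<in>P - B. v ` e = {v x, v y}}"
    then obtain e where P: "P \<in> perfect_matchings H" "B \<subseteq> P" and e: "e \<in> P" "e \<notin> B" "v ` e = {v x, v y}"
      by (auto simp: matchings_with_def)
    obtain a b where ab: "e = {a, b}" "v a = v x" "v b = v y"
      using perfect_matchings_edge_oriented[OF P(1) e(1,3)] .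
    have "a \<notin> e'" if "e' \<in> B" for e'
      using perfect_matchings_unique[OF P(1) _ e(1), of e' a] that P ab e by auto
    then have "(a, b) \<in> I"
      using ab perfect_matchings_edge[OF P(1)] e(1) by (auto simp: I_def cls_def)
    moreover have "P \<in> ?A (a, b)" using P e ab by (auto simp: matchings_with_def)
    ultimately show "P \<in> (\<Union>i\<in>I. ?A i)" by blast
  qed
  then have "real (card {P \<in> matchings_with H B. \<exists>e\<in>P - B. v ` e = {v x, v y}}) \<le> real (card (\<Union>i\<in>I. ?A i))"
    using fI finite_matchings_with by (intro of_nat_mono card_mono) auto
  also have "\<dots> \<le> real (card I) * (r * N B)"
    by (rule card_UN_le_real[OF fI]) (use N_insert cB in \<open>auto simp: I_def\<close>)
  also have "real (card I) \<le> real (card (cls x)) * real (card (cls y))"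
    unfolding of_nat_mult[symmetric] card_cartesian_product[symmetric]
    using I by (intro of_nat_mono card_mono) auto
  also have "\<dots> \<le> \<Delta> * \<Delta>"
    using cls_le x y Delta_ge_1 by (intro mult_mono) auto
  finally show ?thesis using r_pos by (simp add: mult_right_mono power2_eq_square mult_ac)
qed

end

section \<open>Size-bias identities\<close>

lemma abs_sum_diff_le_card:
  fixes f g :: "'a \<Rightarrow> real"
  assumes A: "finite A" and f: "\<And>a. f a \<in> {0..1}" and g: "\<And>a. g a \<in> {0..1}"
    and eq: "\<And>a. a \<in> A \<Longrightarrow> Q a \<Longrightarrow> f a = g a"
  shows "\<bar>(\<Sum>a\<in>A. f a) - (\<Sum>a\<in>A. g a)\<bar> \<le> real (card {a \<in> A. \<not> Q a})"
proof -
  have "\<bar>(\<Sum>a\<in>A. f a) - (\<Sum>a\<in>A. g a)\<bar> \<le> (\<Sum>a\<in>A. \<bar>f a - g a\<bar>)"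
    by (simp add: sum_subtractf[symmetric] sum_abs)
  also have "\<dots> \<le> (\<Sum>a\<in>A. of_bool (\<not> Q a))"
  proof (rule sum_mono)
    fix a assume "a \<in> A"
    then show "\<bar>f a - g a\<bar> \<le> of_bool (\<not> Q a)"
      using eq[of a] f[of a] g[of a] by (cases "Q a") auto
  qed
  also have "\<dots> = real (card {a \<in> A. \<not> Q a})"
    using A by (simp add: Int_def)
  finally show ?thesis .
qed

context bounded_half_edge_system
begin

text \<open>\<open>sum_switch\<close> expresses the sum over matchings through \<open>xy\<close>
  exactly by switched matchings. Replacing their statistics by
  \<open>(loops P + 1, multis P)\<close> is wrong only for non-tame \<open>P\<close>, and division
  by \<open>card H - 1\<close> supplies the second factor \<open>r\<close>.\<close>

lemma sum_switch_loop:
  fixes F :: "nat \<Rightarrow> nat \<Rightarrow> real"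
  assumes xy: "(x, y) \<in> loop_pairs" and F: "\<And>a b. F a b \<in> {0..1}"
  shows "\<bar>(\<Sum>P\<in>matchings_with H {{x, y}}. F (loops P) (multis P)) -
      (\<Sum>P\<in>matchings_with H {}. F (loops P + 1) (multis P)) / (card H - 1)\<bar>
    \<le> \<kappa> * r\<^sup>2 * \<Delta> * N {}"
proof -
  have h: "x \<in> H" "y \<in> H" "x \<noteq> y" "v x = v y" using xy by (auto simp: loop_pairs_def)
  let ?M = "matchings_with H {}"
  let ?d = "(\<Sum>P\<in>?M. F (loops (switch x y P)) (multis (switch x y P))) - (\<Sum>P\<in>?M. F (loops P + 1) (multis P))"
  have "\<bar>?d\<bar> \<le> real (card {P \<in> ?M. \<not> tame v P x y})"
    by (rule abs_sum_diff_le_card)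
      (use F h finite_perfect_matchings[OF fin_H] in \<open>auto simp: tame_switch matchings_with_def\<close>)
  also have "\<dots> \<le> \<kappa> * r * \<Delta> * N {}" by (rule card_not_tame_le) (use h in auto)
  finally have d: "\<bar>?d\<bar> \<le> \<kappa> * r * \<Delta> * N {}" .
  have "(\<Sum>P\<in>?M. F (loops (switch x y P)) (multis (switch x y P))) =
      (card H - 1) * (\<Sum>P\<in>matchings_with H {{x, y}}. F (loops P) (multis P))"
    using sum_switch[OF fin_H, of x "{}" y "\<lambda>P. F (loops P) (multis P)"] h card_H
    by (simp add: of_nat_diff)
  moreover have "\<bar>a - b / l\<bar> = \<bar>l * a - b\<bar> * (1 / l)" if "0 < l" for a b l :: real
  proof -
    have "a - b / l = (l * a - b) * (1 / l)" using that by (simp add: field_simps)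
    then show ?thesis using that by (simp add: abs_mult)
  qed
  ultimately have "\<bar>(\<Sum>P\<in>matchings_with H {{x, y}}. F (loops P) (multis P)) -
      (\<Sum>P\<in>?M. F (loops P + 1) (multis P)) / (card H - 1)\<bar> = \<bar>?d\<bar> * (1 / real (card H - 1))"
    using card_H by simp
  also have "\<dots> \<le> (\<kappa> * r * \<Delta> * N {}) * r"
  proof (rule mult_mono[OF d])
    show "1 / real (card H - 1) \<le> r" using card_H by (simp add: r_def field_simps)
    show "0 \<le> \<kappa> * r * \<Delta> * N {}" using K_nonneg r_pos Delta_ge_1 by (simp add: \<kappa>_def)
  qed simp
  finally show ?thesis by (simp add: power2_eq_square mult_ac)
qed

lemma card_loop_pairs_le: "real (card loop_pairs) \<le> m2"
proof -
  have "loop_pairs \<subseteq> Sigma H cls" by (auto simp: loop_pairs_def cls_def)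
  then have "card loop_pairs \<le> card (Sigma H cls)" by (intro card_mono card_Sigma_cls)
  then show ?thesis using card_Sigma_cls by linarith
qed

text \<open>Twice the number of loops is a sum of indicators over \<open>loop_pairs\<close>;
  exchanging the sums reduces the claim to \<open>sum_switch_loop\<close> for each pair. The at most
  \<open>m2\<close> errors absorb one factor \<open>r\<close> by \<open>r * m2 \<le> K\<close>.
  Weakening \<open>\<Delta>\<close> to \<open>\<Delta>\<^sup>2\<close> gives the same order of error
  as for double edges.\<close>

lemma sum_loops:
  fixes F :: "nat \<Rightarrow> nat \<Rightarrow> real"
  assumes F: "\<And>a b. F a b \<in> {0..1}"
  shows "\<bar>(\<Sum>P\<in>matchings_with H {}. 2 * loops P * F (loops P) (multis P)) -
      real (card loop_pairs) / (card H - 1) * (\<Sum>P\<in>matchings_with H {}. F (loops P + 1) (multis P))\<bar>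
    \<le> K * \<kappa> * (r * \<Delta>\<^sup>2) * N {}"
proof -
  let ?M = "matchings_with H {}"
  let ?s = "(\<Sum>P\<in>?M. F (loops P + 1) (multis P)) / (card H - 1)"
  let ?t = "\<lambda>(x, y). \<Sum>P\<in>matchings_with H {{x, y}}. F (loops P) (multis P)"
  have "(\<Sum>P\<in>?M. 2 * loops P * F (loops P) (multis P)) =
      (\<Sum>P\<in>?M. \<Sum>(x, y)\<in>loop_pairs. of_bool ({x, y} \<in> P) * F (loops P) (multis P))"
  proof (rule sum.cong[OF refl])
    fix P assume "P \<in> ?M"
    then have "real (2 * loops P) = real (card {(x, y) \<in> loop_pairs. {x, y} \<in> P})"
      using loops_eq_card by (simp add: matchings_with_def)
    also have "\<dots> = (\<Sum>(x, y)\<in>loop_pairs. of_bool ({x, y} \<in> P))"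
      using finite_pairs by (simp add: case_prod_unfold Int_def)
    finally show "2 * loops P * F (loops P) (multis P) =
        (\<Sum>(x, y)\<in>loop_pairs. of_bool ({x, y} \<in> P) * F (loops P) (multis P))"
      by (simp add: sum_distrib_right case_prod_unfold)
  qed
  also have "\<dots> = (\<Sum>p\<in>loop_pairs. ?t p)"
    by (subst sum.swap, intro sum.cong refl)
      (auto simp: case_prod_unfold matchings_with_def finite_perfect_matchings fin_H
        intro!: sum.mono_neutral_cong_right)
  finally have "\<bar>(\<Sum>P\<in>?M. 2 * loops P * F (loops P) (multis P)) - real (card loop_pairs) * ?s\<bar> =
      \<bar>\<Sum>p\<in>loop_pairs. ?t p - ?s\<bar>"
    by (simp add: sum_subtractf)
  also have "\<dots> \<le> (\<Sum>p\<in>loop_pairs. \<bar>?t p - ?s\<bar>)" by (rule sum_abs)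
  also have "\<dots> \<le> real (card loop_pairs) * (\<kappa> * r\<^sup>2 * \<Delta> * N {})"
  proof (rule sum_bounded_above)
    fix p assume p: "p \<in> loop_pairs"
    obtain x y where xy: "p = (x, y)" by (cases p)
    show "\<bar>?t p - ?s\<bar> \<le> \<kappa> * r\<^sup>2 * \<Delta> * N {}"
      using sum_switch_loop[OF _ F, of x y] p xy by simp
  qed
  also have "\<dots> \<le> m2 * (\<kappa> * r\<^sup>2 * \<Delta> * N {})"
    using card_loop_pairs_le K_nonneg Delta_ge_1 by (intro mult_right_mono) (auto simp: \<kappa>_def)
  also have "\<dots> = (r * m2) * (\<kappa> * r * \<Delta> * N {})" by (simp add: power2_eq_square)
  also have "\<dots> \<le> K * (\<kappa> * r * \<Delta>\<^sup>2 * N {})"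
    using r_m2 r_pos K_nonneg Delta_ge_1
    by (intro mult_mono mult_left_mono) (auto simp: \<kappa>_def power2_eq_square)
  finally show ?thesis by (simp add: mult_ac)
qed

text \<open>Apart from exceptional matchings, the edges between the two vertices are just the forced
  ones. For distinct vertices the switch then raises \<open>multis\<close> by \<open>card B\<close>:
  by 0 the first time and by 1 the second.\<close>

lemma card_not_tame_parallel_le:
  assumes x: "x \<in> H" and y: "y \<in> H" and "x \<noteq> y" and xB: "x \<notin> \<Union>B" and yB: "y \<notin> \<Union>B"
    and cB: "card B \<le> 1" and B: "\<And>e. e \<in> B \<Longrightarrow> v ` e = {v x, v y}"
  shows "real (card {P \<in> matchings_with H B. \<not> (tame v P x y \<and> edge_mult v P {v x, v y} = card B)})
    \<le> (\<kappa> + 1) * (r * \<Delta>\<^sup>2) * N B"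
proof -
  let ?M = "matchings_with H B"
  let ?A = "{P \<in> ?M. \<not> tame v P x y}" and ?B = "{P \<in> ?M. \<exists>e\<in>P - B. v ` e = {v x, v y}}"
  have "{P \<in> ?M. \<not> (tame v P x y \<and> edge_mult v P {v x, v y} = card B)} \<subseteq> ?A \<union> ?B"
  proof
    fix P assume P: "P \<in> {P \<in> ?M. \<not> (tame v P x y \<and> edge_mult v P {v x, v y} = card B)}"
    show "P \<in> ?A \<union> ?B"
    proof (rule ccontr)
      assume "P \<notin> ?A \<union> ?B"
      then have "{e \<in> P. v ` e = {v x, v y}} = B" "tame v P x y"
        using P B by (auto simp: matchings_with_def)
      then show False using P by (simp add: edge_mult_def)
    qed
  qed
  then have "card {P \<in> ?M. \<not> (tame v P x y \<and> edge_mult v P {v x, v y} = card B)} \<le> card (?A \<union> ?B)"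
    using finite_matchings_with by (intro card_mono) auto
  also have "\<dots> \<le> card ?A + card ?B" by (rule card_Un_le)
  finally have "real (card {P \<in> ?M. \<not> (tame v P x y \<and> edge_mult v P {v x, v y} = card B)}) \<le>
      real (card ?A) + real (card ?B)" by linarith
  also have "\<dots> \<le> \<kappa> * r * \<Delta> * N B + \<Delta>\<^sup>2 * r * N B"
    using assms by (intro add_mono card_not_tame_le card_parallel_le)
  also have "\<kappa> * r * \<Delta> * N B \<le> \<kappa> * r * \<Delta>\<^sup>2 * N B"
    using K_nonneg Delta_ge_1 r_pos by (intro mult_mono) (auto simp: \<kappa>_def power2_eq_square)
  finally show ?thesis by (simp add: algebra_simps)
qed

text \<open>The first switch creates \<open>xy\<close> and usually leaves both statistics alone. The
  second creates \<open>x'y'\<close> while \<open>xy\<close> is kept, and usually raises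
  \<open>multis\<close> by 1.\<close>

lemma sum_switch_double:
  fixes F :: "nat \<Rightarrow> nat \<Rightarrow> real"
  assumes xy: "((x, x'), (y, y')) \<in> double_pairs" and F: "\<And>a b. F a b \<in> {0..1}"
  shows "\<bar>(\<Sum>P\<in>matchings_with H {{x', y'}, {x, y}}. F (loops P) (multis P)) -
      (\<Sum>P\<in>matchings_with H {}. F (loops P) (multis P + 1)) / ((card H - 1) * (card H - 3))\<bar>
    \<le> 2 * ((\<kappa> + 1) * r\<^sup>2 * (r * \<Delta>\<^sup>2) * N {})"
proof -
  have h: "x \<in> H" "y \<in> H" "x' \<in> H" "y' \<in> H" "x \<noteq> y" "x' \<noteq> y'" "v x' = v x" "v y' = v y" "v x \<noteq> v y"
    "x' \<noteq> x" "x' \<noteq> y" "y' \<noteq> x" "y' \<noteq> y"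
    using xy by (auto simp: loop_pairs_def double_pairs_def)
  let ?M = "matchings_with H"
  let ?S = "\<lambda>B f. \<Sum>P\<in>?M B. F (loops (f P)) (multis (f P))"
  let ?T = "\<lambda>B f. \<Sum>P\<in>?M B. F (loops (f P)) (multis (f P) + 1)"
  let ?e = "(\<kappa> + 1) * (r * \<Delta>\<^sup>2)"
  have e0: "0 \<le> ?e" using K_nonneg r_pos by (simp add: \<kappa>_def)
  have l: "0 < real (card H - 1)" "0 < real (card H - 3)" "1 / real (card H - 1) \<le> r" "1 / real (card H - 3) \<le> r"
    using card_H by (auto simp: r_def field_simps)
  have "\<bar>?T {} (switch x y) - ?T {} id\<bar> \<le> real (card {P \<in> ?M {}. \<not> (tame v P x y \<and> edge_mult v P {v x, v y} = card ({} :: 'h set set))})"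
    by (rule abs_sum_diff_le_card)
      (use F h finite_perfect_matchings[OF fin_H] in \<open>auto simp: tame_switch matchings_with_def\<close>)
  also have "\<dots> \<le> ?e * N {}" by (rule card_not_tame_parallel_le) (use h in auto)
  finally have d1: "\<bar>?T {} (switch x y) - ?T {} id\<bar> \<le> ?e * N {}" .
  have "\<bar>?S {{x, y}} (switch x' y') - ?T {{x, y}} id\<bar> \<le>
      real (card {P \<in> ?M {{x, y}}. \<not> (tame v P x' y' \<and> edge_mult v P {v x', v y'} = card {{x, y}})})"
    by (rule abs_sum_diff_le_card)
      (use F h finite_perfect_matchings[OF fin_H] in \<open>auto simp: tame_switch matchings_with_def\<close>)
  also have "\<dots> \<le> ?e * N {{x, y}}" by (rule card_not_tame_parallel_le) (use h in auto)
  also have "\<dots> \<le> ?e * (r * N {})" using N_insert[of x "{}" y] e0 by (intro mult_left_mono) auto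
  finally have d2: "\<bar>?S {{x, y}} (switch x' y') - ?T {{x, y}} id\<bar> \<le> ?e * (r * N {})" .
  have s1: "?T {} (switch x y) = (card H - 1) * ?T {{x, y}} id"
    using sum_switch[OF fin_H, of x "{}" y "\<lambda>P. F (loops P) (multis P + 1)"] h card_H
    by (simp add: of_nat_diff)
  have s2: "?S {{x, y}} (switch x' y') = (card H - 3) * ?S {{x', y'}, {x, y}} id"
    using sum_switch[OF fin_H, of x' "{{x, y}}" y' "\<lambda>P. F (loops P) (multis P)"] h card_H
    by (simp add: of_nat_diff)
  \<comment> \<open>Telescoping over the two switches: \<open>a\<close>, \<open>b\<close>,
    \<open>c\<close> are the sums with two, one and no forced edges, so that
    \<open>l * a - b\<close> is the error of the second switch and \<open>k * b - c\<close> that of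
    the first.\<close>
  have "a - c / (k * l) = (l * a - b) * (1 / l) + (k * b - c) * (1 / l * (1 / k))"
    if "0 < k" "0 < l" for a b c k l :: real
    using that by (simp add: divide_simps) (simp add: algebra_simps)
  from this[OF l(1,2)] have "?S {{x', y'}, {x, y}} id - ?T {} id / ((card H - 1) * (card H - 3)) =
      (?S {{x, y}} (switch x' y') - ?T {{x, y}} id) * (1 / real (card H - 3)) +
      (?T {} (switch x y) - ?T {} id) * (1 / real (card H - 3) * (1 / real (card H - 1)))"
    unfolding s1 s2 by simp
  then have "\<bar>?S {{x', y'}, {x, y}} id - ?T {} id / ((card H - 1) * (card H - 3))\<bar> \<le>
      \<bar>?S {{x, y}} (switch x' y') - ?T {{x, y}} id\<bar> * (1 / real (card H - 3)) +
      \<bar>?T {} (switch x y) - ?T {} id\<bar> * (1 / real (card H - 3) * (1 / real (card H - 1)))"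
    using l(1,2) by (auto simp: abs_mult intro: order_trans[OF abs_triangle_ineq])
  also have "\<dots> \<le> ?e * (r * N {}) * r + ?e * N {} * (r * r)"
    using l d1 d2 e0 r_pos by (intro add_mono mult_mono) auto
  finally show ?thesis by (simp add: power2_eq_square mult_ac)
qed

lemma card_double_pairs_le_m2: "real (card double_pairs) \<le> m2\<^sup>2"
proof -
  have "double_pairs \<subseteq> loop_pairs \<times> loop_pairs" by (auto simp: double_pairs_def)
  then have "card double_pairs \<le> card (loop_pairs \<times> loop_pairs)"
    using finite_pairs by (intro card_mono) auto
  then have "real (card double_pairs) \<le> real (card loop_pairs) * real (card loop_pairs)"
    by (simp only: card_cartesian_product flip: of_nat_mult)
  also have "\<dots> \<le> m2 * m2" using card_loop_pairs_le m2_nonneg by (intro mult_mono) auto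
  finally show ?thesis by (simp add: power2_eq_square)
qed

text \<open>The same exchange of sums as in \<open>sum_loops\<close>. There are at most
  \<open>m2\<^sup>2\<close> tuples, and the two forced edges supply the \<open>r\<^sup>2\<close>
  that turns this into \<open>K\<^sup>2\<close>.\<close>

lemma sum_multis:
  fixes F :: "nat \<Rightarrow> nat \<Rightarrow> real"
  assumes F: "\<And>a b. F a b \<in> {0..1}"
  shows "\<bar>(\<Sum>P\<in>matchings_with H {}. 4 * multis P * F (loops P) (multis P)) -
      real (card double_pairs) / ((card H - 1) * (card H - 3)) *
        (\<Sum>P\<in>matchings_with H {}. F (loops P) (multis P + 1))\<bar>
    \<le> 2 * K\<^sup>2 * (\<kappa> + 1) * (r * \<Delta>\<^sup>2) * N {}"
proof -
  let ?M = "matchings_with H {}"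
  let ?s = "(\<Sum>P\<in>?M. F (loops P) (multis P + 1)) / ((card H - 1) * (card H - 3))"
  let ?t = "\<lambda>((x, x'), (y, y')). \<Sum>P\<in>matchings_with H {{x', y'}, {x, y}}. F (loops P) (multis P)"
  let ?i = "\<lambda>P ((x, x'), (y, y')). {x, y} \<in> P \<and> {x', y'} \<in> P"
  have "(\<Sum>P\<in>?M. 4 * multis P * F (loops P) (multis P)) =
      (\<Sum>P\<in>?M. \<Sum>t\<in>double_pairs. of_bool (?i P t) * F (loops P) (multis P))"
  proof (rule sum.cong[OF refl])
    fix P assume "P \<in> ?M"
    then have "real (4 * multis P) = real (card {t \<in> double_pairs. ?i P t})"
      using multis_eq_card by (simp add: matchings_with_def case_prod_unfold)
    also have "\<dots> = (\<Sum>t\<in>double_pairs. of_bool (?i P t))"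
      using finite_pairs by (simp add: Int_def)
    finally show "4 * multis P * F (loops P) (multis P) =
        (\<Sum>t\<in>double_pairs. of_bool (?i P t) * F (loops P) (multis P))"
      by (simp add: sum_distrib_right)
  qed
  also have "\<dots> = (\<Sum>t\<in>double_pairs. ?t t)"
    by (subst sum.swap, intro sum.cong refl)
      (auto simp: case_prod_unfold matchings_with_def finite_perfect_matchings fin_H
        intro!: sum.mono_neutral_cong_right)
  finally have "\<bar>(\<Sum>P\<in>?M. 4 * multis P * F (loops P) (multis P)) - real (card double_pairs) * ?s\<bar> =
      \<bar>\<Sum>t\<in>double_pairs. ?t t - ?s\<bar>"
    by (simp add: sum_subtractf)
  also have "\<dots> \<le> (\<Sum>t\<in>double_pairs. \<bar>?t t - ?s\<bar>)" by (rule sum_abs)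
  also have "\<dots> \<le> real (card double_pairs) * (2 * ((\<kappa> + 1) * r\<^sup>2 * (r * \<Delta>\<^sup>2) * N {}))"
  proof (rule sum_bounded_above)
    fix t assume t: "t \<in> double_pairs"
    obtain x x' y y' where xy: "t = ((x, x'), (y, y'))" by (metis prod.exhaust)
    show "\<bar>?t t - ?s\<bar> \<le> 2 * ((\<kappa> + 1) * r\<^sup>2 * (r * \<Delta>\<^sup>2) * N {})"
      using sum_switch_double[OF _ F, of x x' y y'] t xy by simp
  qed
  also have "\<dots> \<le> m2\<^sup>2 * (2 * ((\<kappa> + 1) * r\<^sup>2 * (r * \<Delta>\<^sup>2) * N {}))"
    using card_double_pairs_le_m2 K_nonneg r_pos by (intro mult_right_mono) (auto simp: \<kappa>_def)
  also have "\<dots> = (r * m2)\<^sup>2 * (2 * ((\<kappa> + 1) * (r * \<Delta>\<^sup>2) * N {}))" by (simp add: power_mult_distrib)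
  also have "\<dots> \<le> K\<^sup>2 * (2 * ((\<kappa> + 1) * (r * \<Delta>\<^sup>2) * N {}))"
    using r_m2 r_pos K_nonneg m2_nonneg
    by (intro mult_right_mono power_mono) (auto simp: \<kappa>_def)
  finally show ?thesis by (simp add: mult_ac)
qed

text \<open>All pairs of loop pairs qualify except those at the same vertex, of which each loop pair
  has at most \<open>\<Delta>\<^sup>2\<close>. Hence the rate for double edges is nearly the square
  of the rate for loops.\<close>

lemma card_double_pairs_ge:
  "(real (card loop_pairs))\<^sup>2 - card loop_pairs * \<Delta>\<^sup>2 \<le> real (card double_pairs)"
proof -
  let ?E = "SIGMA p:loop_pairs. cls (fst p) \<times> cls (fst p)"
  have "loop_pairs \<times> loop_pairs \<subseteq> double_pairs \<union> ?E"
    by (auto simp: double_pairs_def loop_pairs_def cls_def)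
  moreover have fE: "finite ?E" using finite_pairs by auto
  ultimately have "card (loop_pairs \<times> loop_pairs) \<le> card (double_pairs \<union> ?E)"
    using finite_pairs by (intro card_mono) auto
  also have "\<dots> \<le> card double_pairs + card ?E" by (rule card_Un_le)
  finally have 1: "(real (card loop_pairs))\<^sup>2 \<le> real (card double_pairs) + real (card ?E)"
    by (simp only: card_cartesian_product power2_eq_square flip: of_nat_mult of_nat_add of_nat_le_iff)
  have "real (card ?E) = (\<Sum>p\<in>loop_pairs. real (card (cls (fst p))) * real (card (cls (fst p))))"
    using finite_pairs by (simp add: card_SigmaI card_cartesian_product)
  also have "\<dots> \<le> card loop_pairs * (\<Delta> * \<Delta>)"
  proof (rule sum_bounded_above)
    fix p assume "p \<in> loop_pairs"
    then have "real (card (cls (fst p))) \<le> \<Delta>" by (intro cls_le) (auto simp: loop_pairs_def)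
    then show "real (card (cls (fst p))) * real (card (cls (fst p))) \<le> \<Delta> * \<Delta>"
      by (intro mult_mono) auto
  qed
  finally show ?thesis using 1 by (simp add: power2_eq_square)
qed

lemma card_double_pairs_le_square: "real (card double_pairs) \<le> (real (card loop_pairs))\<^sup>2"
proof -
  have "double_pairs \<subseteq> loop_pairs \<times> loop_pairs" by (auto simp: double_pairs_def)
  then have "card double_pairs \<le> card (loop_pairs \<times> loop_pairs)"
    using finite_pairs by (intro card_mono) auto
  then show ?thesis by (simp only: card_cartesian_product power2_eq_square flip: of_nat_mult of_nat_le_iff)
qed

section \<open>Recursions and tightness for the joint law of loops and double edges\<close>

definition law :: "(nat \<times> nat) pmf" where
  "law = map_pmf (\<lambda>P. (loops P, multis P)) (pmf_of_set (perfect_matchings H))"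

text \<open>Chosen to dominate the errors of both \<open>sum_loops\<close> and
  \<open>sum_multis\<close>.\<close>

definition err :: real where "err = 2 * (K + K\<^sup>2) * (\<kappa> + 1) * (r * \<Delta>\<^sup>2)"

text \<open>For an even number of half-edges this is the mean of twice the number of loops, since a
  given pair is matched with probability 1/(\<open>card H\<close> - 1).\<close>

definition loop_rate :: real where
  "loop_rate = real (card loop_pairs) / (card H - 1)"

definition double_rate :: real where
  "double_rate = real (card double_pairs) / ((card H - 1) * (card H - 3))"

context
  assumes even_H: "even (card H)"
begin

lemma matchings_with_empty: "matchings_with H {} = perfect_matchings H"
  by (simp add: matchings_with_def)

lemma N_pos: "0 < N {}"
  using perfect_matchings_nonempty[OF fin_H even_H] finite_perfect_matchings[OF fin_H]
  by (simp add: matchings_with_empty card_gt_0_iff)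

lemma measure_law:
  "measure_pmf.prob law A = card {P \<in> perfect_matchings H. (loops P, multis P) \<in> A} / N {}"
  using perfect_matchings_nonempty[OF fin_H even_H] finite_perfect_matchings[OF fin_H]
  by (simp add: law_def measure_pmf_of_set matchings_with_empty Int_def vimage_def)

lemma pmf_law:
  "pmf law (a, b) = (\<Sum>P\<in>matchings_with H {}. of_bool (loops P = a \<and> multis P = b)) / N {}"
proof -
  have "pmf law (a, b) = measure_pmf.prob law {(a, b)}" by (simp add: measure_pmf_single)
  also have "\<dots> = (\<Sum>P\<in>matchings_with H {}. of_bool (loops P = a \<and> multis P = b)) / N {}"
    unfolding measure_law using finite_perfect_matchings[OF fin_H]
    by (simp add: matchings_with_empty Int_def)
  finally show ?thesis .
qed

lemma pmf_law_times_N: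
  "(\<Sum>P\<in>matchings_with H {}. of_bool (loops P = a \<and> multis P = b)) = pmf law (a, b) * N {}"
  unfolding pmf_law using N_pos by simp

lemma err_bounds:
  "K * \<kappa> * (r * \<Delta>\<^sup>2) \<le> err" "2 * K\<^sup>2 * (\<kappa> + 1) * (r * \<Delta>\<^sup>2) \<le> err"
proof -
  have "0 \<le> \<kappa>" using K_nonneg by (simp add: \<kappa>_def)
  then have le: "K * \<kappa> \<le> 2 * (K + K\<^sup>2) * (\<kappa> + 1)" "2 * K\<^sup>2 * (\<kappa> + 1) \<le> 2 * (K + K\<^sup>2) * (\<kappa> + 1)"
    using K_nonneg by (auto intro!: mult_mono)
  show "K * \<kappa> * (r * \<Delta>\<^sup>2) \<le> err" "2 * K\<^sup>2 * (\<kappa> + 1) * (r * \<Delta>\<^sup>2) \<le> err"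
    unfolding err_def by (rule mult_right_mono, fact le, use r_pos in simp)+
qed

text \<open>Take for \<open>F\<close> the indicator of \<open>(Suc a, b)\<close>: it turns the
  factor \<open>loops P\<close> into \<open>Suc a\<close>, and after the shift by one it becomes the
  indicator of \<open>(a, b)\<close>.\<close>

lemma law_loops:
  "\<bar>2 * real (Suc a) * pmf law (Suc a, b) - loop_rate * pmf law (a, b)\<bar> \<le> err"
proof -
  let ?M = "matchings_with H {}"
  let ?F = "\<lambda>a' b'. of_bool (a' = Suc a \<and> b' = b) :: real"
  have 1: "(\<Sum>P\<in>?M. 2 * loops P * ?F (loops P) (multis P)) = 2 * real (Suc a) * pmf law (Suc a, b) * N {}"
    unfolding mult.assoc[of _ _ "N {}"] pmf_law_times_N[symmetric] sum_distrib_left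
    by (rule sum.cong) auto
  have 2: "(\<Sum>P\<in>?M. ?F (loops P + 1) (multis P)) = pmf law (a, b) * N {}"
    unfolding pmf_law_times_N[symmetric] by simp
  have "\<bar>(\<Sum>P\<in>?M. 2 * loops P * ?F (loops P) (multis P)) - loop_rate * (\<Sum>P\<in>?M. ?F (loops P + 1) (multis P))\<bar>
      \<le> K * \<kappa> * (r * \<Delta>\<^sup>2) * N {}"
    unfolding loop_rate_def by (rule sum_loops) simp
  then have "\<bar>(2 * real (Suc a) * pmf law (Suc a, b) - loop_rate * pmf law (a, b)) * N {}\<bar>
      \<le> K * \<kappa> * (r * \<Delta>\<^sup>2) * N {}"
    unfolding 1 2 by (simp add: algebra_simps)
  then have "\<bar>2 * real (Suc a) * pmf law (Suc a, b) - loop_rate * pmf law (a, b)\<bar> \<le> K * \<kappa> * (r * \<Delta>\<^sup>2)"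
    using N_pos by (simp only: abs_mult abs_of_pos mult_le_cancel_right_pos)
  then show ?thesis using err_bounds(1) by linarith
qed

lemma law_multis:
  "\<bar>4 * real (Suc b) * pmf law (a, Suc b) - double_rate * pmf law (a, b)\<bar> \<le> err"
proof -
  let ?M = "matchings_with H {}"
  let ?F = "\<lambda>a' b'. of_bool (a' = a \<and> b' = Suc b) :: real"
  have 1: "(\<Sum>P\<in>?M. 4 * multis P * ?F (loops P) (multis P)) = 4 * real (Suc b) * pmf law (a, Suc b) * N {}"
    unfolding mult.assoc[of _ _ "N {}"] pmf_law_times_N[symmetric] sum_distrib_left
    by (rule sum.cong) auto
  have 2: "(\<Sum>P\<in>?M. ?F (loops P) (multis P + 1)) = pmf law (a, b) * N {}"
    unfolding pmf_law_times_N[symmetric] by simp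
  have "\<bar>(\<Sum>P\<in>?M. 4 * multis P * ?F (loops P) (multis P)) - double_rate * (\<Sum>P\<in>?M. ?F (loops P) (multis P + 1))\<bar>
      \<le> 2 * K\<^sup>2 * (\<kappa> + 1) * (r * \<Delta>\<^sup>2) * N {}"
    unfolding double_rate_def by (rule sum_multis) simp
  then have "\<bar>(4 * real (Suc b) * pmf law (a, Suc b) - double_rate * pmf law (a, b)) * N {}\<bar>
      \<le> 2 * K\<^sup>2 * (\<kappa> + 1) * (r * \<Delta>\<^sup>2) * N {}"
    unfolding 1 2 by (simp add: algebra_simps)
  then have "\<bar>4 * real (Suc b) * pmf law (a, Suc b) - double_rate * pmf law (a, b)\<bar> \<le> 2 * K\<^sup>2 * (\<kappa> + 1) * (r * \<Delta>\<^sup>2)"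
    using N_pos by (simp only: abs_mult abs_of_pos mult_le_cancel_right_pos)
  then show ?thesis using err_bounds(2) by linarith
qed

text \<open>Markov's inequality for \<open>2 * loops P + 4 * multis P\<close>, whose mean comes from
  \<open>sum_loops\<close> and \<open>sum_multis\<close> with \<open>F\<close> constantly 1.\<close>

lemma law_tight:
  "measure_pmf.prob law (- ({..k} \<times> {..k})) \<le> (loop_rate + double_rate + 2 * err) / real (Suc k)"
proof -
  let ?M = "matchings_with H {}"
  have 1: "(\<Sum>P\<in>?M. 2 * real (loops P)) \<le> (loop_rate + err) * N {}"
  proof -
    have "\<bar>(\<Sum>P\<in>?M. 2 * real (loops P)) - loop_rate * N {}\<bar> \<le> K * \<kappa> * (r * \<Delta>\<^sup>2) * N {}"
      using sum_loops[of "\<lambda>_ _. 1"] by (simp add: loop_rate_def)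
    also have "\<dots> \<le> err * N {}" by (rule mult_right_mono[OF err_bounds(1)]) simp
    finally show ?thesis unfolding distrib_right by linarith
  qed
  have 2: "(\<Sum>P\<in>?M. 4 * real (multis P)) \<le> (double_rate + err) * N {}"
  proof -
    have "\<bar>(\<Sum>P\<in>?M. 4 * real (multis P)) - double_rate * N {}\<bar> \<le> 2 * K\<^sup>2 * (\<kappa> + 1) * (r * \<Delta>\<^sup>2) * N {}"
      using sum_multis[of "\<lambda>_ _. 1"] by (simp add: double_rate_def)
    also have "\<dots> \<le> err * N {}" by (rule mult_right_mono[OF err_bounds(2)]) simp
    finally show ?thesis unfolding distrib_right by linarith
  qed
  have "real (card {P \<in> perfect_matchings H. (loops P, multis P) \<in> - ({..k} \<times> {..k})}) =
      (\<Sum>P\<in>?M. if k < loops P \<or> k < multis P then 1 else 0)"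
    using finite_perfect_matchings[OF fin_H]
    by (simp add: matchings_with_empty sum.If_cases Int_def not_le de_Morgan_conj)
  also have "\<dots> * real (Suc k) \<le> (\<Sum>P\<in>?M. 2 * real (loops P) + 4 * real (multis P))"
    unfolding sum_distrib_right by (rule sum_mono) auto
  also have "\<dots> \<le> (loop_rate + double_rate + 2 * err) * N {}"
    using 1 2 by (simp add: sum.distrib algebra_simps)
  finally show ?thesis
    unfolding measure_law using N_pos by (simp add: field_simps del: of_nat_Suc)
qed

end

lemma real_card_loop_pairs: "real (card loop_pairs) = m2 - card H"
proof -
  have "loop_pairs = (SIGMA x:H. cls x - {x})" by (auto simp: loop_pairs_def cls_def)
  then have "real (card loop_pairs) = (\<Sum>x\<in>H. real (card (cls x - {x})))"
    using fin_H by (simp add: card_SigmaI)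
  also have "\<dots> = (\<Sum>x\<in>H. real (card (cls x)) - 1)"
  proof (rule sum.cong[OF refl])
    fix x assume "x \<in> H"
    then have "x \<in> cls x" by (simp add: cls_def)
    then have "card (cls x - {x}) = card (cls x) - 1" "card (cls x) \<ge> 1"
      by (auto simp: Suc_le_eq card_gt_0_iff)
    then show "real (card (cls x - {x})) = real (card (cls x)) - 1" by simp
  qed
  finally show ?thesis by (simp add: sum_subtractf m2_def)
qed

end

section \<open>Total variation and the Poisson recursion\<close>

lemma exists_finite_prob_gt:
  fixes q :: "'a :: countable pmf"
  assumes "0 < e"
  obtains A where "finite A" "1 - e < measure_pmf.prob q A"
proof -
  let ?A = "\<lambda>k. {x :: 'a. to_nat x \<le> k}"
  have "(\<lambda>k. measure_pmf.prob q (?A k)) \<longlonglongrightarrow> measure_pmf.prob q (\<Union>k. ?A k)"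
    by (rule measure_pmf.finite_Lim_measure_incseq) (auto simp: incseq_def)
  moreover have "(\<Union>k. ?A k) = UNIV" by auto
  ultimately have "(\<lambda>k. measure_pmf.prob q (?A k)) \<longlonglongrightarrow> 1" by simp
  then have "\<forall>\<^sub>F k in sequentially. 1 - e < measure_pmf.prob q (?A k)"
    using assms by (intro order_tendstoD) auto
  then obtain k where "1 - e < measure_pmf.prob q (?A k)"
    by (auto simp: eventually_sequentially)
  moreover have "finite (?A k)"
    by (rule finite_imageD[of to_nat]) (auto intro: finite_subset[of _ "{..k}"] inj_on_subset[OF inj_to_nat])
  ultimately show thesis using that by blast
qed

lemma tv_dist_nonneg: "0 \<le> tv_dist p q"
  unfolding tv_dist_def
proof (rule cSUP_upper2[where x = "{}"])
  show "bdd_above (range (\<lambda>A. \<bar>measure_pmf.prob p A - measure_pmf.prob q A\<bar>))"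
  proof (rule bdd_aboveI2)
    fix A show "\<bar>measure_pmf.prob p A - measure_pmf.prob q A\<bar> \<le> 1"
      using measure_pmf.prob_le_1[of p A] measure_pmf.prob_le_1[of q A]
        measure_nonneg[of p A] measure_nonneg[of q A] by linarith
  qed
qed auto

text \<open>Only the tail of \<open>q\<close> appears, because the mass of \<open>p\<close> outside
  \<open>A\<close> exceeds that of \<open>q\<close> by at most the sum of differences over
  \<open>A\<close>.\<close>

lemma tv_dist_le_finite:
  fixes p q :: "'a pmf"
  assumes "finite A"
  shows "tv_dist p q \<le> 2 * (\<Sum>x\<in>A. \<bar>pmf p x - pmf q x\<bar>) + 2 * (1 - measure_pmf.prob q A)"
  unfolding tv_dist_def
proof (rule cSUP_least)
  fix T :: "'a set"
  define s where "s = (\<Sum>x\<in>A. \<bar>pmf p x - pmf q x\<bar>)"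
  have close: "\<bar>measure_pmf.prob p B - measure_pmf.prob q B\<bar> \<le> s" if "B \<subseteq> A" for B
  proof -
    have "finite B" using that assms finite_subset by auto
    then have "\<bar>measure_pmf.prob p B - measure_pmf.prob q B\<bar> = \<bar>\<Sum>x\<in>B. pmf p x - pmf q x\<bar>"
      by (simp add: measure_measure_pmf_finite sum_subtractf)
    also have "\<dots> \<le> (\<Sum>x\<in>B. \<bar>pmf p x - pmf q x\<bar>)" by (rule sum_abs)
    also have "\<dots> \<le> s" unfolding s_def using that assms by (intro sum_mono2) auto
    finally show ?thesis .
  qed
  have split: "measure_pmf.prob m T = measure_pmf.prob m (T \<inter> A) + measure_pmf.prob m (T - A)" for m :: "'a pmf"
    by (subst measure_pmf.finite_measure_Union[symmetric]) (auto intro!: arg_cong[where f = "measure_pmf.prob m"])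
  have tail: "measure_pmf.prob m (T - A) \<le> 1 - measure_pmf.prob m A" for m :: "'a pmf"
  proof -
    have "measure_pmf.prob m (T - A) \<le> measure_pmf.prob m (- A)"
      by (rule measure_pmf.finite_measure_mono) auto
    then show ?thesis using measure_pmf.prob_compl[of A m] by (simp add: Compl_eq_Diff_UNIV)
  qed
  have "\<bar>measure_pmf.prob p T - measure_pmf.prob q T\<bar> \<le> s + s + (1 - measure_pmf.prob q A) + (1 - measure_pmf.prob q A)"
    using split[of p] split[of q] tail[of p] tail[of q] close[OF order_refl] close[OF Int_lower2, of T]
      measure_nonneg[of p "T - A"] measure_nonneg[of q "T - A"]
    by linarith
  then show "\<bar>measure_pmf.prob p T - measure_pmf.prob q T\<bar> \<le>
      2 * (\<Sum>x\<in>A. \<bar>pmf p x - pmf q x\<bar>) + 2 * (1 - measure_pmf.prob q A)"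
    unfolding s_def by simp
qed simp

text \<open>A form of Scheffe's lemma. No mass can escape since the pointwise limit has total mass
  1: a finite set carrying most of \<open>q\<close> eventually carries most of
  \<open>p n\<close>.\<close>

lemma tv_dist_tendsto_0:
  fixes p :: "nat \<Rightarrow> 'a :: countable pmf"
  assumes lim: "\<And>x. (\<lambda>n. pmf (p n) x) \<longlonglongrightarrow> pmf q x"
  shows "(\<lambda>n. tv_dist (p n) q) \<longlonglongrightarrow> 0"
proof (rule order_tendstoI)
  fix e :: real assume "0 < e"
  then obtain A where A: "finite A" "1 - e / 4 < measure_pmf.prob q A"
    using exists_finite_prob_gt[of "e / 4" q] by auto
  have "(\<lambda>n. \<Sum>x\<in>A. \<bar>pmf (p n) x - pmf q x\<bar>) \<longlonglongrightarrow> (\<Sum>x\<in>A. \<bar>pmf q x - pmf q x\<bar>)"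
    by (intro tendsto_intros lim)
  then have "\<forall>\<^sub>F n in sequentially. (\<Sum>x\<in>A. \<bar>pmf (p n) x - pmf q x\<bar>) < e / 4"
    using \<open>0 < e\<close> by (intro order_tendstoD) auto
  then show "\<forall>\<^sub>F n in sequentially. tv_dist (p n) q < e"
  proof eventually_elim
    case (elim n)
    have "t < e" if "s < e / 4" "t \<le> 2 * s + 2 * (1 - m)" "1 - e / 4 < m" for s t m :: real
      using that by (simp add: field_simps)
    from this[OF elim tv_dist_le_finite[OF A(1)] A(2)] show ?case .
  qed
next
  fix e :: real assume "e < 0"
  then show "\<forall>\<^sub>F n in sequentially. e < tv_dist (p n) q"
    by (intro always_eventually) (auto intro: less_le_trans[OF _ tv_dist_nonneg])
qed

text \<open>The recursions determine the limiting probabilities up to the value at the origin, and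
  tightness fixes that value.\<close>

lemma poisson_limit_of_recursion:
  fixes p :: "nat \<Rightarrow> (nat \<times> nat) pmf" and \<alpha> \<beta> C :: real
  assumes nonneg: "0 \<le> \<alpha>" "0 \<le> \<beta>"
    and rec1: "\<And>a b. (\<lambda>n. real (Suc a) * pmf (p n) (Suc a, b) - \<alpha> * pmf (p n) (a, b)) \<longlonglongrightarrow> 0"
    and rec2: "\<And>a b. (\<lambda>n. real (Suc b) * pmf (p n) (a, Suc b) - \<beta> * pmf (p n) (a, b)) \<longlonglongrightarrow> 0"
    and tight: "\<And>k. \<forall>\<^sub>F n in sequentially. measure_pmf.prob (p n) (- ({..k} \<times> {..k})) \<le> C / real (Suc k)"
  shows "(\<lambda>n. tv_dist (p n) (pair_pmf (Poi \<alpha>) (Poi \<beta>))) \<longlonglongrightarrow> 0"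
proof -
  \<comment> \<open>The Poisson weights without normalisation, that is, the limiting ratios to the
    mass at the origin.\<close>
  define c where "c = (\<lambda>a b. \<alpha> ^ a / fact a * (\<beta> ^ b / fact b))"
  define p0 where "p0 = (\<lambda>n. pmf (p n) (0, 0))"
  have step: "(\<lambda>n. f n - c' * l / real (Suc m) * p0 n) \<longlonglongrightarrow> 0"
    if "(\<lambda>n. real (Suc m) * f n - l * g n) \<longlonglongrightarrow> 0" "(\<lambda>n. g n - c' * p0 n) \<longlonglongrightarrow> 0"
    for f g :: "nat \<Rightarrow> real" and c' l :: real and m :: nat
  proof -
    have "(\<lambda>n. (real (Suc m) * f n - l * g n) / real (Suc m) + l / real (Suc m) * (g n - c' * p0 n)) \<longlonglongrightarrow>
        0 / real (Suc m) + l / real (Suc m) * 0"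
      by (intro tendsto_intros that) simp
    moreover have "(real (Suc m) * f n - l * g n) / real (Suc m) + l / real (Suc m) * (g n - c' * p0 n) =
        f n - c' * l / real (Suc m) * p0 n" for n
      by (simp add: field_simps del: of_nat_Suc)
    ultimately show ?thesis by simp
  qed
  have c_b: "(\<lambda>n. pmf (p n) (0, b) - c 0 b * p0 n) \<longlonglongrightarrow> 0" for b
  proof (induction b)
    case 0
    then show ?case by (simp add: c_def p0_def)
  next
    case (Suc b)
    have "c 0 b * \<beta> / real (Suc b) = c 0 (Suc b)" by (simp add: c_def field_simps)
    with step[OF rec2 Suc] show ?case by (simp only:)
  qed
  have c_ab: "(\<lambda>n. pmf (p n) (a, b) - c a b * p0 n) \<longlonglongrightarrow> 0" for a b
  proof (induction a)
    case 0
    then show ?case by (rule c_b)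
  next
    case (Suc a)
    have "c a b * \<alpha> / real (Suc a) = c (Suc a) b" by (simp add: c_def field_simps)
    with step[OF rec1 Suc] show ?case by (simp only:)
  qed
  define S where "S = (\<lambda>k. \<Sum>x\<in>{..k} \<times> {..k}. c (fst x) (snd x))"
  have S_lim: "S \<longlonglongrightarrow> exp (\<alpha> + \<beta>)"
  proof -
    have e: "(\<lambda>k. \<Sum>a\<le>k. x ^ a / fact a) \<longlonglongrightarrow> exp x" for x :: real
      using exp_converges[of x] by (simp add: sums_def_le divide_inverse mult.commute)
    have "S = (\<lambda>k. (\<Sum>a\<le>k. \<alpha> ^ a / fact a) * (\<Sum>b\<le>k. \<beta> ^ b / fact b))"
      by (simp add: S_def c_def sum_product sum.cartesian_product case_prod_unfold)
    then show ?thesis using tendsto_mult[OF e[of \<alpha>] e[of \<beta>]] by (simp add: exp_add)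
  qed
  \<comment> \<open>The mass of a large square is about \<open>S k * p0 n\<close>, and tightness
    makes it close to 1. The three thirds of \<open>e\<close> pay for the tail, for replacing
    \<open>S k\<close> by its limit, and for the finitely many recursions at fixed
    \<open>k\<close>.\<close>
  have p0_lim: "(\<lambda>n. exp (\<alpha> + \<beta>) * p0 n) \<longlonglongrightarrow> 1"
  proof (rule LIMSEQ_I)
    fix e :: real assume e: "0 < e"
    have "(\<lambda>k. C / real (Suc k)) \<longlonglongrightarrow> 0"
      using tendsto_mult_left[OF LIMSEQ_inverse_real_of_nat, of C] by (simp add: divide_inverse)
    then have "\<forall>\<^sub>F k in sequentially. C / real (Suc k) < e / 3"
      using e by (intro order_tendstoD) auto
    moreover have "\<forall>\<^sub>F k in sequentially. \<bar>S k - exp (\<alpha> + \<beta>)\<bar> < e / 3"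
      using tendstoD[OF S_lim, of "e / 3"] e by (simp add: dist_real_def)
    ultimately have "\<forall>\<^sub>F k in sequentially. C / real (Suc k) < e / 3 \<and> \<bar>S k - exp (\<alpha> + \<beta>)\<bar> < e / 3"
      by eventually_elim simp
    then obtain k where k: "C / real (Suc k) < e / 3" "\<bar>S k - exp (\<alpha> + \<beta>)\<bar> < e / 3"
      by (auto simp: eventually_sequentially)
    let ?A = "{..k} \<times> {..k}"
    have "(\<lambda>n. \<Sum>x\<in>?A. pmf (p n) (fst x, snd x) - c (fst x) (snd x) * p0 n) \<longlonglongrightarrow> (\<Sum>x\<in>?A. 0)"
      by (intro tendsto_sum c_ab)
    then have "(\<lambda>n. measure_pmf.prob (p n) ?A - S k * p0 n) \<longlonglongrightarrow> 0" (is "?f \<longlonglongrightarrow> 0")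
      by (simp add: measure_measure_pmf_finite sum_subtractf S_def sum_distrib_right)
    then have "\<forall>\<^sub>F n in sequentially. \<bar>measure_pmf.prob (p n) ?A - S k * p0 n\<bar> < e / 3"
      using tendstoD[of ?f 0 sequentially "e / 3"] e by (simp add: dist_real_def)
    then have "\<forall>\<^sub>F n in sequentially. norm (exp (\<alpha> + \<beta>) * p0 n - 1) < e"
      using tight[of k]
    proof eventually_elim
      case (elim n)
      have "\<bar>(exp (\<alpha> + \<beta>) - S k) * p0 n\<bar> \<le> \<bar>exp (\<alpha> + \<beta>) - S k\<bar> * 1"
        unfolding abs_mult by (intro mult_left_mono) (simp_all add: p0_def pmf_le_1)
      then have "\<bar>exp (\<alpha> + \<beta>) * p0 n - S k * p0 n\<bar> < e / 3" using k(2) by (simp add: left_diff_distrib abs_minus_commute[of "S k"])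
      moreover have "measure_pmf.prob (p n) (- ?A) = 1 - measure_pmf.prob (p n) ?A"
        using measure_pmf.prob_compl[of ?A "p n"] by (simp add: Compl_eq_Diff_UNIV)
      moreover have "measure_pmf.prob (p n) ?A \<le> 1" by simp
      ultimately show ?case using elim k(1) unfolding real_norm_def by linarith
    qed
    then show "\<exists>N. \<forall>n\<ge>N. norm (exp (\<alpha> + \<beta>) * p0 n - 1) < e"
      by (simp add: eventually_sequentially)
  qed
  have "p0 \<longlonglongrightarrow> exp (- \<alpha>) * exp (- \<beta>)"
    using tendsto_mult_left[OF p0_lim, of "exp (- (\<alpha> + \<beta>))"]
    by (simp add: mult.assoc[symmetric] exp_add[symmetric] exp_minus_inverse)
  then have "(\<lambda>n. (pmf (p n) (a, b) - c a b * p0 n) + c a b * p0 n) \<longlonglongrightarrow>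
      0 + c a b * (exp (- \<alpha>) * exp (- \<beta>))" for a b
    by (intro tendsto_intros c_ab)
  then have "(\<lambda>n. pmf (p n) (a, b)) \<longlonglongrightarrow> pmf (pair_pmf (Poi \<alpha>) (Poi \<beta>)) (a, b)" for a b
    using nonneg by (simp add: pmf_pair pmf_Poi c_def mult_ac)
  then show ?thesis by (intro tv_dist_tendsto_0) (simp add: split_paired_all)
qed

section \<open>The configuration model\<close>

lemma count_multigraph_of_matching:
  assumes "finite P"
  shows "count (multigraph_of_matching P) f = edge_mult fst P f"
proof -
  have "(\<lambda>e. fst ` e) -` {f} \<inter> P = {e \<in> P. fst ` e = f}" by auto
  then show ?thesis
    using assms by (simp add: multigraph_of_matching_def count_image_mset edge_mult_def)
qed

lemma finite_half_edges: "finite (half_edges n d)"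
  by (simp add: half_edges_def)

lemma card_half_edges: "card (half_edges n d) = (\<Sum>i\<in>{1..n}. d i)"
  by (simp add: half_edges_def)

lemma card_half_edges_at:
  assumes "x \<in> half_edges n d"
  shows "card {z \<in> half_edges n d. fst z = fst x} = d (fst x)"
proof -
  have "{z \<in> half_edges n d. fst z = fst x} = {fst x} \<times> {..<d (fst x)}"
    using assms by (auto simp: half_edges_def)
  then show ?thesis by (simp add: card_cartesian_product)
qed

lemma sum_half_edges_degree:
  "(\<Sum>x\<in>half_edges n d. real (card {z \<in> half_edges n d. fst z = fst x})) = (\<Sum>i\<in>{1..n}. (real (d i))\<^sup>2)"
proof -
  have "(\<Sum>x\<in>half_edges n d. real (card {z \<in> half_edges n d. fst z = fst x})) =
      (\<Sum>(i, k)\<in>half_edges n d. real (d i))"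
    by (rule sum.cong) (auto simp: card_half_edges_at)
  also have "\<dots> = (\<Sum>i\<in>{1..n}. \<Sum>k\<in>{..<d i}. real (d i))"
    unfolding half_edges_def by (rule sum.Sigma[symmetric]) auto
  finally show ?thesis by (simp add: power2_eq_square)
qed

text \<open>The first term of \<open>e\<close> is \<open>err\<close> with \<open>r = 2 / l\<close>
  and \<open>\<kappa> + 1\<close> written out. The second pays for replacing the number of double
  pairs by the square \<open>(q - l)\<^sup>2\<close>, as allowed by
  \<open>card_double_pairs_ge\<close>.\<close>

lemma configuration_model_recursion:
  fixes n :: nat and d :: "nat \<Rightarrow> nat" and \<Delta> K l q :: real
  defines "p \<equiv> map_pmf (\<lambda>G. (self_loops n G, multi_edges n G)) (configuration_model n d)"
  assumes l: "l = (\<Sum>i\<in>{1..n}. real (d i))" and q: "q = (\<Sum>i\<in>{1..n}. (real (d i))\<^sup>2)"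
    and even: "even (\<Sum>i\<in>{1..n}. d i)" and l_ge: "14 \<le> l"
    and \<Delta>: "\<And>i. i \<in> {1..n} \<Longrightarrow> real (d i) \<le> \<Delta>" and K: "q \<le> K * l / 2"
  defines "t \<equiv> (q - l) / (l - 1)" and "u \<equiv> (q - l)\<^sup>2 / ((l - 1) * (l - 3))"
    and "e \<equiv> 4 * (K + K\<^sup>2) * (5 + 3 * K + K\<^sup>2) * (\<Delta>\<^sup>2 / l) + (q - l) * \<Delta>\<^sup>2 / ((l - 1) * (l - 3))"
  shows "\<bar>2 * real (Suc a) * pmf p (Suc a, b) - t * pmf p (a, b)\<bar> \<le> e"
    and "\<bar>4 * real (Suc b) * pmf p (a, Suc b) - u * pmf p (a, b)\<bar> \<le> e"
    and "measure_pmf.prob p (- ({..k} \<times> {..k})) \<le> (t + u + 2 * e) / real (Suc k)"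
proof -
  let ?H = "half_edges n d"
  have cH: "real (card ?H) = l" by (simp add: card_half_edges l)
  interpret bounded_half_edge_system ?H fst "{1..n}" \<Delta> K
  proof
    show "fst x \<in> {1..n}" if "x \<in> ?H" for x using that by (auto simp: half_edges_def)
    show "14 \<le> card ?H" using l_ge cH by linarith
    show "real (card {z \<in> ?H. fst z = fst x}) \<le> \<Delta>" if "x \<in> ?H" for x
      using that \<Delta>[of "fst x"] card_half_edges_at[OF that] by (auto simp: half_edges_def)
    show "(\<Sum>x\<in>?H. real (card {z \<in> ?H. fst z = fst x})) \<le> K * real (card ?H) / 2"
      unfolding sum_half_edges_degree cH q[symmetric] by (rule K)
  qed (simp_all add: finite_half_edges)
  have ev: "even (card ?H)" using even by (simp add: card_half_edges)
  have counts: "self_loops n (multigraph_of_matching P) = loops P"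
    "multi_edges n (multigraph_of_matching P) = multis P" if "P \<in> perfect_matchings ?H" for P
  proof -
    have *: "edge_count (multigraph_of_matching P) i j = edge_mult fst P {i, j}" for i j
      using finite_perfect_matching[OF fin_H that]
      by (simp add: edge_count_def count_multigraph_of_matching)
    show "self_loops n (multigraph_of_matching P) = loops P"
      by (simp only: self_loops_def loops_def * insert_absorb2)
    show "multi_edges n (multigraph_of_matching P) = multis P"
      unfolding multi_edges_def multis_def * by (intro sum.cong) auto
  qed
  have p: "p = law"
    unfolding p_def law_def configuration_model_def map_pmf_comp
    using perfect_matchings_nonempty[OF fin_H ev] finite_perfect_matchings[OF fin_H]
    by (intro map_pmf_cong refl) (simp add: counts)
  have lp: "real (card loop_pairs) = q - l"
    by (simp add: real_card_loop_pairs m2_def cls_def sum_half_edges_degree cH q)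
  then have ql: "0 \<le> q - l" by (metis of_nat_0_le_iff)
  have r1: "real (card ?H - 1) = l - 1" "real (card ?H - 3) = l - 3"
    using card_H cH by (simp_all add: of_nat_diff)
  have lr: "loop_rate = t" by (simp only: loop_rate_def t_def lp r1)
  define \<delta> where "\<delta> = (q - l) * \<Delta>\<^sup>2 / ((l - 1) * (l - 3))"
  have pos: "0 < (l - 1) * (l - 3)" using l_ge by simp
  have \<delta>: "0 \<le> \<delta>" using ql pos by (simp add: \<delta>_def)
  have dr: "double_rate \<le> u" "u - \<delta> \<le> double_rate"
    unfolding double_rate_def u_def \<delta>_def of_nat_mult r1 diff_divide_distrib[symmetric]
    using card_double_pairs_ge[unfolded lp] card_double_pairs_le_square[unfolded lp] pos
    by (auto intro!: divide_right_mono simp del: zero_less_mult_iff)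
  have e: "e = err + \<delta>"
    by (simp add: e_def err_def \<delta>_def r_def cH \<kappa>_def algebra_simps)
  show "\<bar>2 * real (Suc a) * pmf p (Suc a, b) - t * pmf p (a, b)\<bar> \<le> e"
    using law_loops[OF ev, of a b] \<delta> unfolding p lr e by linarith
  have "\<bar>(double_rate - u) * pmf p (a, b)\<bar> \<le> \<delta> * 1"
    unfolding abs_mult using dr \<delta> by (intro mult_mono) (auto simp: pmf_le_1)
  then show "\<bar>4 * real (Suc b) * pmf p (a, Suc b) - u * pmf p (a, b)\<bar> \<le> e"
    using law_multis[OF ev, of b a] unfolding p e left_diff_distrib by linarith
  have "measure_pmf.prob p (- ({..k} \<times> {..k})) \<le> (loop_rate + double_rate + 2 * err) / real (Suc k)"
    unfolding p by (rule law_tight[OF ev])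
  also have "\<dots> \<le> (t + u + 2 * e) / real (Suc k)"
    using dr(1) \<delta> by (intro divide_right_mono) (auto simp: lr e)
  finally show "measure_pmf.prob p (- ({..k} \<times> {..k})) \<le> (t + u + 2 * e) / real (Suc k)" .
qed

section \<open>Degree moments and the maximal degree\<close>

lemma expectation_degree_pmf:
  assumes "0 < n"
  shows "measure_pmf.expectation (degree_pmf n d) f = (\<Sum>i\<in>{1..n}. f (real (d i))) / real n"
  using assms by (simp add: degree_pmf_def integral_pmf_of_set)

text \<open>Convergence of the second moments makes \<open>D\<^sub>n\<^sup>2\<close> uniformly integrable, and a single vertex
  contributes \<open>d\<^sub>i\<^sup>2 / n\<close> to the second moment.\<close>

lemma max_degree_negligible:
  fixes d :: "nat \<Rightarrow> nat \<Rightarrow> nat" and \<Omega> :: "'a measure" and D :: "'a \<Rightarrow> real"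
  assumes prob: "prob_space \<Omega>"
    and rv: "D \<in> borel_measurable \<Omega>"
    and conv_dist: "weak_conv_m (\<lambda>n. distr (measure_pmf (degree_pmf n (d n))) borel (\<lambda>x. x))
                                (distr \<Omega> borel D)"
    and int2: "integrable \<Omega> (\<lambda>\<omega>. (D \<omega>)\<^sup>2)"
    and conv2: "(\<lambda>n. measure_pmf.expectation (degree_pmf n (d n)) (\<lambda>x. x\<^sup>2))
                  \<longlonglongrightarrow> (LINT \<omega>|\<Omega>. (D \<omega>)\<^sup>2)"
  shows "(\<lambda>n. (real (Max (d n ` {1..n})))\<^sup>2 / real n) \<longlonglongrightarrow> 0"
proof (rule order_tendstoI)
  fix e :: real assume "0 < e"
  interpret prob_space \<Omega> by (rule prob)
  let ?E = "\<lambda>n f. measure_pmf.expectation (degree_pmf n (d n)) f"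
  let ?m = "LINT \<omega>|\<Omega>. (D \<omega>)\<^sup>2"
  \<comment> \<open>Convergence in distribution only controls bounded continuous functions, hence
    the truncation of the square at \<open>c\<close>.\<close>
  have trunc: "(\<lambda>n. ?E n (\<lambda>x. min (x\<^sup>2) (real c))) \<longlonglongrightarrow> (LINT \<omega>|\<Omega>. min ((D \<omega>)\<^sup>2) (real c))" for c :: nat
  proof -
    have rd: "real_distribution (distr (measure_pmf (degree_pmf n (d n))) borel (\<lambda>x. x))" for n
      by (rule prob_space.real_distribution_distr) (auto intro: measure_pmf.prob_space_axioms)
    have rd': "real_distribution (distr \<Omega> borel D)"
      using rv by (rule real_distribution_distr)
    have "(\<lambda>n. integral\<^sup>L (distr (measure_pmf (degree_pmf n (d n))) borel (\<lambda>x. x)) (\<lambda>x. min (x\<^sup>2) (real c)))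
        \<longlonglongrightarrow> integral\<^sup>L (distr \<Omega> borel D) (\<lambda>x. min (x\<^sup>2) (real c))"
    proof (rule weak_conv_imp_integral_bdd_continuous_conv[OF rd rd' conv_dist])
      show "isCont (\<lambda>x. min (x\<^sup>2) (real c)) x" for x :: real by (intro continuous_intros)
      show "norm (min (x\<^sup>2) (real c)) \<le> real c" for x :: real by (simp add: min_def)
    qed
    then show ?thesis using rv by (simp add: integral_distr)
  qed
  have "(\<lambda>c. LINT \<omega>|\<Omega>. min ((D \<omega>)\<^sup>2) (real c)) \<longlonglongrightarrow> ?m"
  proof (rule integral_dominated_convergence[where w = "\<lambda>\<omega>. (D \<omega>)\<^sup>2"])
    show "AE \<omega> in \<Omega>. (\<lambda>c. min ((D \<omega>)\<^sup>2) (real c)) \<longlonglongrightarrow> (D \<omega>)\<^sup>2"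
    proof (rule AE_I2)
      fix \<omega>
      have "\<forall>\<^sub>F c in sequentially. (D \<omega>)\<^sup>2 \<le> real c"
        using filterlim_real_sequentially by (simp add: filterlim_at_top)
      then have "\<forall>\<^sub>F c in sequentially. min ((D \<omega>)\<^sup>2) (real c) = (D \<omega>)\<^sup>2"
        by eventually_elim simp
      then show "(\<lambda>c. min ((D \<omega>)\<^sup>2) (real c)) \<longlonglongrightarrow> (D \<omega>)\<^sup>2" by (rule tendsto_eventually)
    qed
    show "AE \<omega> in \<Omega>. norm (min ((D \<omega>)\<^sup>2) (real c)) \<le> (D \<omega>)\<^sup>2" for c
      by (rule AE_I2) (simp add: min_def)
  qed (use rv int2 in auto)
  then have "\<forall>\<^sub>F c in sequentially. ?m - e < (LINT \<omega>|\<Omega>. min ((D \<omega>)\<^sup>2) (real c))"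
    using \<open>0 < e\<close> by (intro order_tendstoD) auto
  then obtain c :: nat where c: "?m - (LINT \<omega>|\<Omega>. min ((D \<omega>)\<^sup>2) (real c)) < e"
    by (auto simp: eventually_sequentially algebra_simps)
  have "(\<lambda>n. real c / real n + (?E n (\<lambda>x. x\<^sup>2) - ?E n (\<lambda>x. min (x\<^sup>2) (real c)))) \<longlonglongrightarrow>
      0 + (?m - (LINT \<omega>|\<Omega>. min ((D \<omega>)\<^sup>2) (real c)))"
    by (intro tendsto_add tendsto_diff conv2 trunc lim_const_over_n)
  then have "\<forall>\<^sub>F n in sequentially. real c / real n + (?E n (\<lambda>x. x\<^sup>2) - ?E n (\<lambda>x. min (x\<^sup>2) (real c))) < e"
    using c by (intro order_tendstoD) auto
  then show "\<forall>\<^sub>F n in sequentially. (real (Max (d n ` {1..n})))\<^sup>2 / real n < e"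
    using eventually_gt_at_top[of 0]
  proof eventually_elim
    case (elim n)
    let ?f = "\<lambda>i. (real (d n i))\<^sup>2 - min ((real (d n i))\<^sup>2) (real c)"
    have "Max (d n ` {1..n}) \<in> d n ` {1..n}" using elim(2) by (intro Max_in) auto
    then obtain i where i: "i \<in> {1..n}" "Max (d n ` {1..n}) = d n i" by auto
    \<comment> \<open>The square is at most \<open>c\<close> plus its excess over \<open>c\<close>.
      The excess of one vertex is at most the sum over all vertices, which after division by
      \<open>n\<close> is the difference between the full and the truncated second moment.\<close>
    have "(real (d n i))\<^sup>2 \<le> real c + ?f i" by (simp add: min_def)
    also have "?f i \<le> (\<Sum>i\<in>{1..n}. ?f i)"
      using i(1) by (intro member_le_sum) auto
    finally have "(real (d n i))\<^sup>2 / real n \<le> (real c + (\<Sum>i\<in>{1..n}. ?f i)) / real n"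
      by (intro divide_right_mono) auto
    also have "\<dots> = real c / real n + (?E n (\<lambda>x. x\<^sup>2) - ?E n (\<lambda>x. min (x\<^sup>2) (real c)))"
      using elim(2) by (simp add: expectation_degree_pmf sum_subtractf add_divide_distrib diff_divide_distrib)
    finally show ?case using elim(1) i(2) by simp
  qed
next
  fix e :: real assume "e < 0"
  then show "\<forall>\<^sub>F n in sequentially. e < (real (Max (d n ` {1..n})))\<^sup>2 / real n"
    by (intro always_eventually) (auto intro: less_le_trans)
qed

theorem theorem1p4:
  fixes d :: "nat \<Rightarrow> nat \<Rightarrow> nat" and \<Omega> :: "'a measure" and D :: "'a \<Rightarrow> real" and \<nu> :: real
  assumes deg_pos: "\<And>n i. i \<in> {1..n} \<Longrightarrow> d n i > 0"
    and deg_even: "\<And>n. even (\<Sum>i\<in>{1..n}. d n i)"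
    and prob: "prob_space \<Omega>"
    and rv: "D \<in> borel_measurable \<Omega>"
    and conv_dist: "weak_conv_m (\<lambda>n. distr (measure_pmf (degree_pmf n (d n))) borel (\<lambda>x. x))
                                (distr \<Omega> borel D)"
    and int1: "integrable \<Omega> D"
    and conv1: "(\<lambda>n. measure_pmf.expectation (degree_pmf n (d n)) (\<lambda>x. x))
                  \<longlonglongrightarrow> (LINT \<omega>|\<Omega>. D \<omega>)"
    and int2: "integrable \<Omega> (\<lambda>\<omega>. (D \<omega>)\<^sup>2)"
    and conv2: "(\<lambda>n. measure_pmf.expectation (degree_pmf n (d n)) (\<lambda>x. x\<^sup>2))
                  \<longlonglongrightarrow> (LINT \<omega>|\<Omega>. (D \<omega>)\<^sup>2)"
    and nu: "\<nu> = (LINT \<omega>|\<Omega>. D \<omega> * (D \<omega> - 1)) / (LINT \<omega>|\<Omega>. D \<omega>)"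
  shows "(\<lambda>n. tv_dist
            (map_pmf (\<lambda>G. (self_loops n G, multi_edges n G)) (configuration_model n (d n)))
            (pair_pmf (Poi (\<nu> / 2)) (Poi (\<nu>\<^sup>2 / 4))))
         \<longlonglongrightarrow> 0"
proof -
  define M1 where "M1 = (LINT \<omega>|\<Omega>. D \<omega>)"
  define M2 where "M2 = (LINT \<omega>|\<Omega>. (D \<omega>)\<^sup>2)"
  define l where "l = (\<lambda>n. \<Sum>i\<in>{1..n}. real (d n i))"
  define q where "q = (\<lambda>n. \<Sum>i\<in>{1..n}. (real (d n i))\<^sup>2)"
  define \<Delta> where "\<Delta> = (\<lambda>n. real (Max (d n ` {1..n})))"
  \<comment> \<open>Any constant above the limit of \<open>q n / l n\<close> would do.
    \<open>K\<close> is twice that, to match the form \<open>q \<le> K * l / 2\<close>.\<close>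
  define c where "c = M2 / M1 + 1"
  define K where "K = 2 * c"
  define p where "p = (\<lambda>n. map_pmf (\<lambda>G. (self_loops n G, multi_edges n G)) (configuration_model n (d n)))"
  define t where "t = (\<lambda>n. (q n - l n) / (l n - 1))"
  define u where "u = (\<lambda>n. (q n - l n)\<^sup>2 / ((l n - 1) * (l n - 3)))"
  define e where "e = (\<lambda>n. 4 * (K + K\<^sup>2) * (5 + 3 * K + K\<^sup>2) * ((\<Delta> n)\<^sup>2 / l n) +
    (q n - l n) * (\<Delta> n)\<^sup>2 / ((l n - 1) * (l n - 3)))"
  have l_ge: "real n \<le> l n" for n
  proof -
    have "(\<Sum>i\<in>{1..n}. 1) \<le> l n"
      unfolding l_def using deg_pos by (intro sum_mono) (simp add: Suc_leI)
    then show ?thesis by simp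
  qed
  have L: "(\<lambda>n. l n / real n) \<longlonglongrightarrow> M1"
    using conv1 unfolding M1_def
    by (rule Lim_transform_eventually)
      (use eventually_gt_at_top[of 0] in \<open>eventually_elim, simp add: expectation_degree_pmf l_def\<close>)
  have Q: "(\<lambda>n. q n / real n) \<longlonglongrightarrow> M2"
    using conv2 unfolding M2_def
    by (rule Lim_transform_eventually)
      (use eventually_gt_at_top[of 0] in \<open>eventually_elim, simp add: expectation_degree_pmf q_def\<close>)
  have \<Delta>: "(\<lambda>n. (\<Delta> n)\<^sup>2 / real n) \<longlonglongrightarrow> 0"
    unfolding \<Delta>_def by (rule max_degree_negligible[OF prob rv conv_dist int2 conv2])
  \<comment> \<open>Obtained from the positive integer degrees rather than from \<open>D\<close>; it
    justifies all later divisions by \<open>M1\<close>.\<close>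
  have M1: "1 \<le> M1"
  proof (rule tendsto_lowerbound[OF L])
    show "\<forall>\<^sub>F n in sequentially. 1 \<le> l n / real n"
      using eventually_gt_at_top[of 0] by eventually_elim (use l_ge in simp)
  qed simp
  have nu': "\<nu> = (M2 - M1) / M1"
    unfolding nu M1_def M2_def using int1 int2
    by (simp add: right_diff_distrib power2_eq_square)
  have lk: "(\<lambda>n. l n / real n - k / real n) \<longlonglongrightarrow> M1" for k :: real
    using tendsto_diff[OF L lim_const_over_n[of k]] by simp
  have cancel: "a / m * (b / m) / (c / m * (d / m)) = a * b / (c * d)"
    and cancel': "a / m / (b / m) = a / b" if "0 < m" for a b c d m :: real
    using that by simp_all
  have t: "t \<longlonglongrightarrow> \<nu>"
  proof -
    have "(\<lambda>n. (q n / real n - l n / real n) / (l n / real n - 1 / real n)) \<longlonglongrightarrow> \<nu>"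
      unfolding nu' using M1 by (intro tendsto_intros Q L lk) simp
    then show ?thesis
      by (rule Lim_transform_eventually)
        (use eventually_gt_at_top[of 0] in \<open>eventually_elim, simp add: t_def flip: diff_divide_distrib\<close>)
  qed
  have u: "u \<longlonglongrightarrow> \<nu>\<^sup>2"
  proof -
    have "(\<lambda>n. (q n / real n - l n / real n)\<^sup>2 /
        ((l n / real n - 1 / real n) * (l n / real n - 3 / real n))) \<longlonglongrightarrow> (M2 - M1)\<^sup>2 / (M1 * M1)"
      using M1 by (intro tendsto_intros Q L lk) simp
    moreover have "(M2 - M1)\<^sup>2 / (M1 * M1) = \<nu>\<^sup>2" by (simp add: nu' power_divide power2_eq_square)
    ultimately have "(\<lambda>n. (q n / real n - l n / real n)\<^sup>2 /
        ((l n / real n - 1 / real n) * (l n / real n - 3 / real n))) \<longlonglongrightarrow> \<nu>\<^sup>2" by simp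
    then show ?thesis
    proof (rule Lim_transform_eventually)
      show "\<forall>\<^sub>F n in sequentially. (q n / real n - l n / real n)\<^sup>2 /
          ((l n / real n - 1 / real n) * (l n / real n - 3 / real n)) = u n"
        using eventually_gt_at_top[of 0]
        by eventually_elim
          (simp only: u_def power2_eq_square cancel of_nat_0_less_iff flip: diff_divide_distrib)
    qed
  qed
  have e: "e \<longlonglongrightarrow> 0"
  proof -
    have "(\<lambda>n. 4 * (K + K\<^sup>2) * (5 + 3 * K + K\<^sup>2) * (((\<Delta> n)\<^sup>2 / real n) / (l n / real n)) +
        (q n / real n - l n / real n) * ((\<Delta> n)\<^sup>2 / real n) /
        ((l n / real n - 1 / real n) * (l n / real n - 3 / real n))) \<longlonglongrightarrow>
        4 * (K + K\<^sup>2) * (5 + 3 * K + K\<^sup>2) * (0 / M1) + (M2 - M1) * 0 / (M1 * M1)"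
      using M1 by (intro tendsto_intros Q L lk \<Delta>) simp_all
    then have "(\<lambda>n. 4 * (K + K\<^sup>2) * (5 + 3 * K + K\<^sup>2) * (((\<Delta> n)\<^sup>2 / real n) / (l n / real n)) +
        (q n / real n - l n / real n) * ((\<Delta> n)\<^sup>2 / real n) /
        ((l n / real n - 1 / real n) * (l n / real n - 3 / real n))) \<longlonglongrightarrow> 0" by simp
    then show ?thesis
    proof (rule Lim_transform_eventually)
      show "\<forall>\<^sub>F n in sequentially. 4 * (K + K\<^sup>2) * (5 + 3 * K + K\<^sup>2) * (((\<Delta> n)\<^sup>2 / real n) / (l n / real n)) +
          (q n / real n - l n / real n) * ((\<Delta> n)\<^sup>2 / real n) /
          ((l n / real n - 1 / real n) * (l n / real n - 3 / real n)) = e n"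
        using eventually_gt_at_top[of 0]
        by eventually_elim
          (simp only: e_def cancel cancel' of_nat_0_less_iff flip: diff_divide_distrib)
    qed
  qed
  have good: "\<forall>\<^sub>F n in sequentially. 14 \<le> l n \<and> q n \<le> K * l n / 2"
  proof -
    have "(\<lambda>n. (q n / real n) / (l n / real n)) \<longlonglongrightarrow> M2 / M1"
      using M1 by (intro tendsto_intros Q L) simp
    then have "\<forall>\<^sub>F n in sequentially. (q n / real n) / (l n / real n) < c"
      by (rule order_tendstoD) (simp add: c_def)
    then show ?thesis
      using eventually_ge_at_top[of 14]
    proof eventually_elim
      case (elim n)
      then have l: "14 \<le> l n" using l_ge[of n] by linarith
      have "q n / l n < c" using elim cancel'[of "real n" "q n" "l n"] by simp
      then have "q n < c * l n" using l by (simp only: divide_less_eq)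
      with l show ?case by (simp add: K_def)
    qed
  qed
  have \<Delta>_ge: "real (d n i) \<le> \<Delta> n" if "i \<in> {1..n}" for n i
    unfolding \<Delta>_def using that by simp
  have rec: "\<bar>2 * real (Suc a) * pmf (p n) (Suc a, b) - t n * pmf (p n) (a, b)\<bar> \<le> e n"
    "\<bar>4 * real (Suc b) * pmf (p n) (a, Suc b) - u n * pmf (p n) (a, b)\<bar> \<le> e n"
    "measure_pmf.prob (p n) (- ({..k} \<times> {..k})) \<le> (t n + u n + 2 * e n) / real (Suc k)"
    if "14 \<le> l n \<and> q n \<le> K * l n / 2" for n a b k
    unfolding p_def t_def u_def e_def
    by (rule configuration_model_recursion[OF fun_cong[OF l_def] fun_cong[OF q_def] deg_even _ \<Delta>_ge];
        use that in simp)+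
  \<comment> \<open>Passes from the rate \<open>s\<close> at finite \<open>n\<close> to its limit
    \<open>c\<close>: as \<open>y\<close> is a probability, this costs at most the distance of the
    rates, and division by \<open>m\<close> (2 for loops, 4 for double edges) does not increase the
    error.\<close>
  have scale: "\<bar>x - c / m * y\<bar> \<le> r + \<bar>s - c\<bar>"
    if "\<bar>m * x - s * y\<bar> \<le> r" "0 \<le> y" "y \<le> 1" "1 \<le> m" for x y s r c m :: real
  proof -
    have "\<bar>(s - c) * y\<bar> \<le> \<bar>s - c\<bar>"
      unfolding abs_mult using that by (intro mult_left_le) auto
    then have "\<bar>m * x - c * y\<bar> \<le> r + \<bar>s - c\<bar>" using that(1) unfolding left_diff_distrib by linarith
    moreover have "m * x - c * y = m * (x - c / m * y)" using that by (simp add: field_simps)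
    moreover have "1 * \<bar>x - c / m * y\<bar> \<le> m * \<bar>x - c / m * y\<bar>"
      using that by (intro mult_right_mono) auto
    ultimately show ?thesis using that by (simp add: abs_mult)
  qed
  have "(\<lambda>n. real (Suc a) * pmf (p n) (Suc a, b) - \<nu> / 2 * pmf (p n) (a, b)) \<longlonglongrightarrow> 0" for a b
  proof (rule Lim_null_comparison)
    show "(\<lambda>n. e n + \<bar>t n - \<nu>\<bar>) \<longlonglongrightarrow> 0"
      using tendsto_add[OF e tendsto_rabs_zero[OF LIM_zero[OF t]]] by simp
    show "\<forall>\<^sub>F n in sequentially.
        norm (real (Suc a) * pmf (p n) (Suc a, b) - \<nu> / 2 * pmf (p n) (a, b)) \<le> e n + \<bar>t n - \<nu>\<bar>"
      using good
    proof eventually_elim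
      case (elim n)
      show ?case
        unfolding real_norm_def
        by (rule scale) (use rec(1)[OF elim, of a b] in \<open>simp_all add: pmf_le_1 mult.assoc del: of_nat_Suc\<close>)
    qed
  qed
  moreover have "(\<lambda>n. real (Suc b) * pmf (p n) (a, Suc b) - \<nu>\<^sup>2 / 4 * pmf (p n) (a, b)) \<longlonglongrightarrow> 0" for a b
  proof (rule Lim_null_comparison)
    show "(\<lambda>n. e n + \<bar>u n - \<nu>\<^sup>2\<bar>) \<longlonglongrightarrow> 0"
      using tendsto_add[OF e tendsto_rabs_zero[OF LIM_zero[OF u]]] by simp
    show "\<forall>\<^sub>F n in sequentially.
        norm (real (Suc b) * pmf (p n) (a, Suc b) - \<nu>\<^sup>2 / 4 * pmf (p n) (a, b)) \<le> e n + \<bar>u n - \<nu>\<^sup>2\<bar>"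
      using good
    proof eventually_elim
      case (elim n)
      show ?case
        unfolding real_norm_def
        by (rule scale) (use rec(2)[OF elim, of b a] in \<open>simp_all add: pmf_le_1 mult.assoc del: of_nat_Suc\<close>)
    qed
  qed
  moreover have "\<forall>\<^sub>F n in sequentially.
      measure_pmf.prob (p n) (- ({..k} \<times> {..k})) \<le> (\<nu> + \<nu>\<^sup>2 + 1) / real (Suc k)" for k
  proof -
    have "(\<lambda>n. t n + u n + 2 * e n) \<longlonglongrightarrow> \<nu> + \<nu>\<^sup>2 + 2 * 0" by (intro tendsto_intros t u e)
    then have "\<forall>\<^sub>F n in sequentially. t n + u n + 2 * e n < \<nu> + \<nu>\<^sup>2 + 1"
      by (rule order_tendstoD) simp
    then show ?thesis
      using good
    proof eventually_elim
      case (elim n)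
      have "(t n + u n + 2 * e n) / real (Suc k) \<le> (\<nu> + \<nu>\<^sup>2 + 1) / real (Suc k)"
        using elim(1) by (intro divide_right_mono) auto
      with rec(3)[OF elim(2), of k] show ?case by linarith
    qed
  qed
  \<comment> \<open>The sign is read off from the integer degrees, for which
    \<open>d \<le> d\<^sup>2\<close>. The value 0 is possible; both Poisson laws are then point
    masses at 0.\<close>
  moreover have "0 \<le> \<nu>"
  proof (rule tendsto_lowerbound[OF t])
    show "\<forall>\<^sub>F n in sequentially. 0 \<le> t n"
      using good
    proof eventually_elim
      case (elim n)
      have "l n \<le> q n"
        unfolding l_def q_def using deg_pos
        by (intro sum_mono) (simp add: power2_eq_square Suc_leI)
      then show ?case using elim by (simp add: t_def)
    qed
  qed simp
  ultimately have "(\<lambda>n. tv_dist (p n) (pair_pmf (Poi (\<nu> / 2)) (Poi (\<nu>\<^sup>2 / 4)))) \<longlonglongrightarrow> 0"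
    by (intro poisson_limit_of_recursion) auto
  then show ?thesis by (simp add: p_def)
qed

end
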